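(* Let $p,s$ be two positive integers with $p\leq s$, and let $\alpha$ be a positive real number. If $\psi$ is a bounded radial function on $\mathbb{D}$ such that $T_{e^{is\theta}\psi}$ commutes with $T_{e^{ip\theta}r^\alpha}$ on $L^2_h$, then either $s=p$ and $\psi=c\,r^\alpha$ for some constant $c$, or $\psi=0$.
   Context: $\mathbb{D}$ is the open unit disk of the complex plane and $dA=r\,dr\,\frac{d\theta}{\pi}$ is normalized Lebesgue measure on $\mathbb{D}$. The harmonic Bergman space $L^2_h$ is the closed subspace of $L^2(\mathbb{D},dA)$ consisting of all harmonic functions on $\mathbb{D}$, and $Q$ is the orthogonal projection of $L^2(\mathbb{D},dA)$ onto $L^2_h$. For a bounded (measurable) function $f$ on $\mathbb{D}$, the Toeplitz operator $T_f:L^2_h\to L^2_h$ with symbol $f$ is $T_f(u)=Q(fu)$. A function $\phi$ on $\mathbb{D}$ is radial if $\phi(z)$ depends only on $r=|z|$; $e^{ip\theta}\phi$ denotes the function $re^{i\theta}\mapsto e^{ip\theta}\phi(r)$, and $r^\alpha$ denotes the radial function $z\mapsto |z|^\alpha$. Equality of symbols is understood almost everywhere. Constants are complex numbers. *)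

theory Defs
  imports "HOL-Analysis.Analysis"
begin

text \<open>
  A function on the unit disk is represented by a total function on the complex plane; nothing
  below depends on its values outside the disk.
\<close>

abbreviation disk :: "complex set" where
  "disk \<equiv> ball 0 1"

definition dA :: "complex measure" where
  "dA = density (lebesgue_on disk) (\<lambda>_. ennreal (1 / pi))"

text \<open>Square-integrable functions, not identified modulo null sets.\<close>

definition L2 :: "(complex \<Rightarrow> complex) set" where
  "L2 = {f \<in> borel_measurable dA. integrable dA (\<lambda>z. (cmod (f z))\<^sup>2)}"

definition L2_inner :: "(complex \<Rightarrow> complex) \<Rightarrow> (complex \<Rightarrow> complex) \<Rightarrow> complex" where
  "L2_inner f g = (LINT z|dA. f z * cnj (g z))"

text \<open>
  Twice continuously (real) differentiable with vanishing Laplacian, for complex-valued functions;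
  the witnesses are the partial derivatives with respect to
  \<open>x = Re z\<close> and \<open>y = Im z\<close>.
\<close>

definition harmonic_on :: "(complex \<Rightarrow> complex) \<Rightarrow> complex set \<Rightarrow> bool" where
  "harmonic_on u S \<longleftrightarrow>
     (\<exists>ux uy uxx uxy uyx uyy :: complex \<Rightarrow> complex.
        (\<forall>z\<in>S. (u has_derivative (\<lambda>h. Re h *\<^sub>R ux z + Im h *\<^sub>R uy z)) (at z)
             \<and> (ux has_derivative (\<lambda>h. Re h *\<^sub>R uxx z + Im h *\<^sub>R uxy z)) (at z)
             \<and> (uy has_derivative (\<lambda>h. Re h *\<^sub>R uyx z + Im h *\<^sub>R uyy z)) (at z)
             \<and> uxx z + uyy z = 0)
        \<and> continuous_on S uxx \<and> continuous_on S uxy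
        \<and> continuous_on S uyx \<and> continuous_on S uyy)"

definition harmonic_Bergman :: "(complex \<Rightarrow> complex) set" where
  "harmonic_Bergman = {u \<in> L2. harmonic_on u disk}"

text \<open>
  For \<open>f \<in> L2\<close> the projection is determined on the disk: two harmonic functions that agree
  almost everywhere there are equal there. The choice operator only picks the
  irrelevant values outside the disk.
\<close>

definition Q :: "(complex \<Rightarrow> complex) \<Rightarrow> complex \<Rightarrow> complex" where
  "Q f = (SOME u. u \<in> harmonic_Bergman \<and>
            (\<forall>v\<in>harmonic_Bergman. L2_inner (\<lambda>z. f z - u z) v = 0))"

definition Toeplitz :: "(complex \<Rightarrow> complex) \<Rightarrow> (complex \<Rightarrow> complex) \<Rightarrow> complex \<Rightarrow> complex" where
  "Toeplitz f u = Q (\<lambda>z. f z * u z)"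

definition commute_on_Bergman ::
  "((complex \<Rightarrow> complex) \<Rightarrow> complex \<Rightarrow> complex) \<Rightarrow>
   ((complex \<Rightarrow> complex) \<Rightarrow> complex \<Rightarrow> complex) \<Rightarrow> bool" where
  "commute_on_Bergman S T \<longleftrightarrow>
     (\<forall>u\<in>harmonic_Bergman. \<forall>z\<in>disk. S (T u) z = T (S u) z)"

definition radial :: "(complex \<Rightarrow> complex) \<Rightarrow> bool" where
  "radial \<phi> \<longleftrightarrow> (\<forall>z\<in>disk. \<forall>w\<in>disk. cmod z = cmod w \<longrightarrow> \<phi> z = \<phi> w)"

text \<open>The symbol \<open>e\<^bsup>ip\<theta>\<^esup>\<phi>\<close>; the value at the origin, where
  the angle is not determined, is immaterial.\<close>

definition twist :: "nat \<Rightarrow> (complex \<Rightarrow> complex) \<Rightarrow> complex \<Rightarrow> complex" where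
  "twist p \<phi> z = cis (real p * Arg z) * \<phi> z"

definition radial_power :: "real \<Rightarrow> complex \<Rightarrow> complex" where
  "radial_power \<alpha> z = complex_of_real (cmod z powr \<alpha>)"

end

theory Submission
  imports Defs "HOL-Complex_Analysis.Cauchy_Integral_Formula"
begin

text \<open>
  Let \<open>e\<^sub>k\<close> be \<open>z\<^sup>k\<close> for \<open>k \<ge> 0\<close> and the conjugate of \<open>z\<^bsup>-k\<^esup>\<close> for \<open>k < 0\<close>.  By rotation
  invariance of the area measure, \<open>T\<close> with symbol \<open>e\<^bsup>is\<theta>\<^esup>\<psi>\<close> maps \<open>e\<^sub>k\<close> to
  \<open>(\<bar>k+s\<bar>+1) M(\<bar>k\<bar>+\<bar>k+s\<bar>) e\<^bsub>k+s\<^esub>\<close> with \<open>M(n) = \<integral> \<psi> \<bar>z\<bar>\<^sup>n dA\<close>, and for \<open>r\<^sup>\<alpha>\<close> the moments are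
  \<open>2/(n+\<alpha>+2)\<close>.  Commutation on the \<open>e\<^sub>k\<close> is therefore a recurrence for \<open>M\<close>.  At \<open>k = -p\<close> it forces
  \<open>s = p\<close> or \<open>M(s) = 0\<close>; at \<open>-p \<le> k \<le> 0\<close> it determines \<open>M(s), M(s+2), \<dots>, M(s+2p)\<close> from \<open>M(s)\<close>,
  and at \<open>k \<ge> 0\<close> it passes from \<open>M(s+2k)\<close> to \<open>M(s+2k+2p)\<close>.  So all moments \<open>M(s+2j)\<close> agree with
  those of \<open>c r\<^sup>\<alpha>\<close> for some \<open>c\<close>, with \<open>c = 0\<close> unless \<open>s = p\<close>, and a bounded radial function is
  determined by such moments by the Weierstrass theorem.
\<close>

section \<open>Rotation invariance of Lebesgue measure\<close>

definition complex_of_vec :: "real ^ 2 \<Rightarrow> complex" where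
  "complex_of_vec v = Complex (v $ 1) (v $ 2)"

definition vec_of_complex :: "complex \<Rightarrow> real ^ 2" where
  "vec_of_complex z = vector [Re z, Im z]"

lemma complex_of_vec_of_complex [simp]: "complex_of_vec (vec_of_complex z) = z"
  and vec_of_complex_of_vec [simp]: "vec_of_complex (complex_of_vec v) = v"
  by (auto simp: complex_of_vec_def vec_of_complex_def vec_eq_iff forall_2)

lemma norm_complex_of_vec: "norm (complex_of_vec v) = norm v"
  by (simp add: complex_of_vec_def norm_complex_def norm_vec_def L2_set_def sum_2)

lemma norm_vec_of_complex: "norm (vec_of_complex z) = norm z"
  by (metis complex_of_vec_of_complex norm_complex_of_vec)

lemma linear_complex_of_vec: "linear complex_of_vec"
  by (auto intro!: linearI simp: complex_of_vec_def complex_eq_iff)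

lemma linear_vec_of_complex: "linear vec_of_complex"
  by (auto intro!: linearI simp: vec_of_complex_def vec_eq_iff forall_2)

lemma vimage_complex_of_vec_box:
  "complex_of_vec -` box l u = box (vec_of_complex l) (vec_of_complex u)"
  by (auto simp: box_def complex_of_vec_def vec_of_complex_def Basis_complex_def Basis_vec_def
        inner_axis forall_2)

text \<open>
  The library has invariance under orthogonal maps only for \<open>real ^ 'n\<close>, hence the detour through
  \<open>real ^ 2\<close>.
\<close>

lemma distr_complex_of_vec: "distr lborel borel complex_of_vec = lborel"
proof (rule sym, rule lborel_eqI)
  fix l u :: complex assume *: "\<And>b. b \<in> Basis \<Longrightarrow> l \<bullet> b \<le> u \<bullet> b"
  have le: "Re l \<le> Re u" "Im l \<le> Im u"
    using *[of 1] *[of \<i>] by (auto simp: Basis_complex_def)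
  have [measurable]: "complex_of_vec \<in> borel \<rightarrow>\<^sub>M borel"
    using linear_complex_of_vec
    by (intro borel_measurable_continuous_onI) (simp add: linear_continuous_on linear_conv_bounded_linear)
  have "(\<Prod>b\<in>(Basis :: (real^2) set). (vec_of_complex u - vec_of_complex l) \<bullet> b) =
        (\<Prod>b\<in>Basis. (u - l) \<bullet> b)"
    by (simp add: Basis_complex_def axis_eq_axis Basis_vec_def UNION_singleton_eq_range prod.reindex inj_on_def
        UNIV_2 vec_of_complex_def inner_axis image_image)
  moreover have "\<forall>b\<in>Basis. vec_of_complex l \<bullet> b \<le> vec_of_complex u \<bullet> b"
    using le by (auto simp: Basis_vec_def inner_axis vec_of_complex_def forall_2)
  ultimately show "emeasure (distr lborel borel complex_of_vec) (box l u) = (\<Prod>b\<in>Basis. (u - l) \<bullet> b)"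
    by (simp add: emeasure_distr vimage_complex_of_vec_box emeasure_lborel_box_eq)
qed simp

text \<open>It is enough to compare the two measures on boxes. The preimage of a box under
  multiplication by \<open>\<omega>\<close>, read in \<open>real ^ 2\<close>, is the image of a box
  under the orthogonal map \<open>R\<close>, which is multiplication by \<open>cnj \<omega>\<close>,
  the inverse of \<open>\<omega>\<close>; orthogonal maps preserve measure.\<close>

lemma distr_lborel_rotation:
  assumes "cmod \<omega> = 1"
  shows "distr lborel borel ((*) \<omega>) = lborel"
proof (rule sym, rule lborel_eqI)
  fix l u :: complex assume le: "\<And>b. b \<in> Basis \<Longrightarrow> l \<bullet> b \<le> u \<bullet> b"
  define R where "R v = vec_of_complex (cnj \<omega> * complex_of_vec v)" for v
  have \<omega>: "\<omega> * cnj \<omega> = 1" "cnj \<omega> * \<omega> = 1"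
    using assms by (auto simp: complex_norm_square[symmetric] mult.commute)
  have [measurable]: "complex_of_vec \<in> borel \<rightarrow>\<^sub>M borel"
    using linear_complex_of_vec
    by (intro borel_measurable_continuous_onI) (simp add: linear_continuous_on linear_conv_bounded_linear)
  have R: "orthogonal_transformation R"
    unfolding orthogonal_transformation
  proof
    show "linear R"
      unfolding R_def
      using linear_compose[OF linear_compose[OF linear_complex_of_vec, of "(*) (cnj \<omega>)"] linear_vec_of_complex]
      by (simp add: o_def linear_times)
    show "\<forall>v. norm (R v) = norm v"
      by (simp add: R_def norm_vec_of_complex norm_complex_of_vec norm_mult assms)
  qed
  let ?B = "box (vec_of_complex l) (vec_of_complex u)"
  have eq: "complex_of_vec -` (*) \<omega> -` box l u = R ` ?B"
  proof (intro set_eqI iffI)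
    fix v assume "v \<in> complex_of_vec -` (*) \<omega> -` box l u"
    then have "vec_of_complex (\<omega> * complex_of_vec v) \<in> ?B"
      by (simp flip: vimage_complex_of_vec_box)
    moreover have "v = R (vec_of_complex (\<omega> * complex_of_vec v))"
      by (simp add: R_def \<omega> flip: mult.assoc)
    ultimately show "v \<in> R ` ?B" by blast
  next
    fix v assume "v \<in> R ` ?B"
    then obtain w where "w \<in> ?B" "v = R w" by blast
    then show "v \<in> complex_of_vec -` (*) \<omega> -` box l u"
      by (simp add: R_def \<omega> flip: mult.assoc vimage_complex_of_vec_box)
  qed
  have B: "?B \<in> lmeasurable" by simp
  have RB: "R ` ?B \<in> lmeasurable" using measurable_orthogonal_image[OF R B] .
  \<comment> \<open>Invariance under orthogonal maps is a statement about \<open>lebesgue\<close>,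
    the push-forward one about \<open>lborel\<close>; Borel measurability of the image allows
    passing between them.\<close>
  have RB': "R ` ?B \<in> sets borel"
  proof -
    have "complex_of_vec -` (*) \<omega> -` box l u \<inter> space borel \<in> sets borel"
      by measurable
    then show ?thesis using eq by simp
  qed
  have "emeasure (distr lborel borel ((*) \<omega>)) (box l u) = emeasure lborel ((*) \<omega> -` box l u)"
    by (simp add: emeasure_distr)
  also have "\<dots> = emeasure (distr lborel borel complex_of_vec) ((*) \<omega> -` box l u)"
    by (simp add: distr_complex_of_vec)
  also have "\<dots> = emeasure lborel (R ` ?B)"
  proof -
    have "(*) \<omega> -` box l u \<inter> space borel \<in> sets borel"
      by measurable
    then show ?thesis by (simp add: emeasure_distr eq)
  qed
  also have "\<dots> = emeasure lebesgue (R ` ?B)" using RB' by simp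
  also have "\<dots> = emeasure lebesgue ?B"
    using measure_orthogonal_image[OF R B] B RB by (simp add: emeasure_eq_measure2)
  also have "\<dots> = emeasure (distr lborel borel complex_of_vec) (box l u)"
    by (simp add: emeasure_distr vimage_complex_of_vec_box)
  also have "\<dots> = (\<Prod>b\<in>Basis. (u - l) \<bullet> b)"
    using le by (simp add: distr_complex_of_vec emeasure_lborel_box)
  finally show "emeasure (distr lborel borel ((*) \<omega>)) (box l u) = (\<Prod>b\<in>Basis. (u - l) \<bullet> b)" .
qed simp

text \<open>The symbols are only Lebesgue measurable, so invariance has to be carried over to the
  completion; completing commutes with this push-forward.\<close>

lemma
  assumes "cmod \<omega> = 1"
  shows measurable_lebesgue_rotation: "(*) \<omega> \<in> lebesgue \<rightarrow>\<^sub>M lebesgue"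
    and distr_lebesgue_rotation: "distr lebesgue lebesgue ((*) \<omega>) = lebesgue"
proof -
  have d: "distr lebesgue lborel ((*) \<omega>) = lborel"
    using distr_lborel_rotation[OF assms] by (simp add: distr_completion cong: distr_cong)
  show "(*) \<omega> \<in> lebesgue \<rightarrow>\<^sub>M lebesgue"
    by (rule completion.measurable_completion2) (simp_all add: d measurable_completion)
  have "distr lebesgue lebesgue ((*) \<omega>) = completion (distr lebesgue lborel ((*) \<omega>))"
    by (subst completion.completion_distr_eq) (simp_all add: d measurable_completion)
  then show "distr lebesgue lebesgue ((*) \<omega>) = lebesgue" by (simp add: d)
qed

lemma lebesgue_integral_rotation:
  fixes f :: "complex \<Rightarrow> complex"
  assumes "cmod \<omega> = 1" and "f \<in> borel_measurable lebesgue"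
  shows "(LINT z|lebesgue. f (\<omega> * z)) = (LINT z|lebesgue. f z)"
  using integral_distr[OF measurable_lebesgue_rotation[OF assms(1)] assms(2)]
  by (simp add: distr_lebesgue_rotation[OF assms(1)])

section \<open>Harmonic functions\<close>

lemma has_real_derivative_component:
  fixes u :: "complex \<Rightarrow> real"
  assumes "(u has_derivative (\<lambda>h. Re h * a + Im h * b)) (at (z + of_real t * d))"
  shows "((\<lambda>t. u (z + of_real t * d)) has_real_derivative (Re d * a + Im d * b)) (at t)"
proof -
  have "((\<lambda>t. z + of_real t * d) has_derivative (\<lambda>t. of_real t * d)) (at t)"
    by (auto intro!: derivative_eq_intros)
  from has_derivative_compose[OF this assms] show ?thesis
    unfolding has_field_derivative_def
    by (rule has_derivative_eq_rhs) (simp add: fun_eq_iff algebra_simps)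
qed

text \<open>The mean value theorem is used twice: in direction \<open>d\<close> for the difference
  \<open>g\<close> of \<open>u\<close> along two parallel segments, then in direction
  \<open>e\<close> for the directional derivative \<open>v\<close>. With arbitrary directions,
  exchanging \<open>d\<close> and \<open>e\<close> expresses one and the same second difference
  through either mixed partial.\<close>

lemma second_difference_mvt:
  fixes u :: "complex \<Rightarrow> real"
  assumes h: "h > 0" and S: "\<And>s t. 0 \<le> s \<Longrightarrow> s \<le> h \<Longrightarrow> 0 \<le> t \<Longrightarrow> t \<le> h \<Longrightarrow> z + of_real s * d + of_real t * e \<in> S"
    and u: "\<And>w. w \<in> S \<Longrightarrow> (u has_derivative (\<lambda>h. Re h * ux w + Im h * uy w)) (at w)"
    and v: "\<And>w. w \<in> S \<Longrightarrow> ((\<lambda>w. Re d * ux w + Im d * uy w) has_derivative (\<lambda>h. Re h * vx w + Im h * vy w)) (at w)"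
  shows "\<exists>s t. 0 < s \<and> s < h \<and> 0 < t \<and> t < h \<and>
    u (z + of_real h * d + of_real h * e) - u (z + of_real h * d) - u (z + of_real h * e) + u z
     = h * h * (Re e * vx (z + of_real s * d + of_real t * e) + Im e * vy (z + of_real s * d + of_real t * e))"
proof -
  define g where "g s = u (z + of_real h * e + of_real s * d) - u (z + of_real s * d)" for s
  define v where "v w = Re d * ux w + Im d * uy w" for w
  have "\<exists>s. 0 < s \<and> s < h \<and> g h - g 0 = (h - 0) * (v (z + of_real h * e + of_real s * d) - v (z + of_real s * d))"
  proof (rule MVT2)
    fix s :: real assume s: "0 \<le> s" "s \<le> h"
    have "z + of_real h * e + of_real s * d \<in> S" "z + of_real s * d \<in> S"
      using S[of s h] S[of s 0] h s by (auto simp: algebra_simps)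
    then show "(g has_real_derivative (v (z + of_real h * e + of_real s * d) - v (z + of_real s * d))) (at s)"
      unfolding g_def v_def by (intro DERIV_diff has_real_derivative_component u)
  qed fact
  then obtain s where s: "0 < s" "s < h"
    and gs: "g h - g 0 = h * (v (z + of_real h * e + of_real s * d) - v (z + of_real s * d))" by auto
  define k where "k t = v (z + of_real s * d + of_real t * e)" for t
  define k' where "k' t = (let w = z + of_real s * d + of_real t * e in Re e * vx w + Im e * vy w)" for t
  have "\<exists>t. 0 < t \<and> t < h \<and> k h - k 0 = (h - 0) * k' t"
  proof (rule MVT2)
    fix t :: real assume t: "0 \<le> t" "t \<le> h"
    have "z + of_real s * d + of_real t * e \<in> S"
      using S[of s t] s t by auto
    then show "(k has_real_derivative k' t) (at t)"
      unfolding k_def k'_def v_def Let_def by (intro has_real_derivative_component assms(4))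
  qed fact
  then obtain t where t: "0 < t" "t < h" "k h - k 0 = h * k' t" by auto
  show ?thesis
  proof (intro exI conjI)
    have "g h - g 0 = h * (h * k' t)"
      using gs t(3) by (simp add: k_def algebra_simps)
    then show "u (z + of_real h * d + of_real h * e) - u (z + of_real h * d) - u (z + of_real h * e) + u z
     = h * h * (Re e * vx (z + of_real s * d + of_real t * e) + Im e * vy (z + of_real s * d + of_real t * e))"
      by (simp add: g_def k'_def Let_def algebra_simps)
  qed (use s t in auto)
qed

text \<open>The second difference over a small square is \<open>h * h\<close> times
  \<open>uxy\<close> at one point and \<open>h * h\<close> times \<open>uyx\<close> at another. Both
  points are close to \<open>z\<close>, so continuity rules out a gap between the two values at
  \<open>z\<close>.\<close>

lemma symmetric_second_partials_real:
  fixes u :: "complex \<Rightarrow> real"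
  assumes "open S" and z: "z \<in> S"
    and u: "\<And>w. w \<in> S \<Longrightarrow> (u has_derivative (\<lambda>h. Re h * ux w + Im h * uy w)) (at w)"
    and ux: "\<And>w. w \<in> S \<Longrightarrow> (ux has_derivative (\<lambda>h. Re h * uxx w + Im h * uxy w)) (at w)"
    and uy: "\<And>w. w \<in> S \<Longrightarrow> (uy has_derivative (\<lambda>h. Re h * uyx w + Im h * uyy w)) (at w)"
    and c: "continuous_on S uxy" "continuous_on S uyx"
  shows "uxy z = uyx z"
proof (rule ccontr)
  assume "uxy z \<noteq> uyx z"
  \<comment> \<open>Half the gap: values strictly within this distance of \<open>uxy z\<close> and
    of \<open>uyx z\<close> cannot coincide.\<close>
  define \<epsilon> where "\<epsilon> = \<bar>uxy z - uyx z\<bar> / 2"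
  have \<epsilon>: "\<epsilon> > 0" using \<open>uxy z \<noteq> uyx z\<close> by (simp add: \<epsilon>_def)
  have "isCont uxy z" "isCont uyx z"
    using c \<open>open S\<close> z by (auto simp: continuous_on_eq_continuous_at)
  then have "\<exists>d>0. \<forall>w. dist w z < d \<longrightarrow> dist (uxy w) (uxy z) < \<epsilon>"
    "\<exists>d>0. \<forall>w. dist w z < d \<longrightarrow> dist (uyx w) (uyx z) < \<epsilon>"
    using \<epsilon> by (simp_all add: continuous_at_eps_delta)
  then obtain d1 d2 where d: "d1 > 0" "\<And>w. dist w z < d1 \<Longrightarrow> dist (uxy w) (uxy z) < \<epsilon>"
    "d2 > 0" "\<And>w. dist w z < d2 \<Longrightarrow> dist (uyx w) (uyx z) < \<epsilon>"
    by blast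
  obtain d3 where d3: "d3 > 0" "ball z d3 \<subseteq> S" using \<open>open S\<close> z by (meson openE)
  \<comment> \<open>Points of the square are within \<open>2 * h\<close> of \<open>z\<close>, hence
    strictly within \<open>3 * h\<close>, which is at most each of the three radii.\<close>
  define h where "h = Min {d1, d2, d3} / 3"
  have h: "h > 0" "3 * h \<le> d1" "3 * h \<le> d2" "3 * h \<le> d3" using d d3 by (auto simp: h_def)
  have near: "dist (z + of_real s * a + of_real t * b) z < 3 * h"
    if "0 \<le> s" "s \<le> h" "0 \<le> t" "t \<le> h" "cmod a = 1" "cmod b = 1" for s t a b
  proof -
    have "dist (z + of_real s * a + of_real t * b) z = cmod (of_real s * a + of_real t * b)"
      by (simp add: dist_norm)
    also have "\<dots> \<le> s + t"
      using norm_triangle_ineq[of "of_real s * a" "of_real t * b"] that by (simp add: norm_mult)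
    finally show ?thesis using that h by simp
  qed
  have S: "z + of_real s * a + of_real t * b \<in> S"
    if "0 \<le> s" "s \<le> h" "0 \<le> t" "t \<le> h" "cmod a = 1" "cmod b = 1" for s t a b
    using near[OF that] h d3 by (auto simp: dist_commute)
  have S1: "z + of_real s * 1 + of_real t * \<i> \<in> S" "z + of_real s * \<i> + of_real t * 1 \<in> S"
    if "0 \<le> s" "s \<le> h" "0 \<le> t" "t \<le> h" for s t
    using S[OF that, of 1 \<i>] S[OF that, of \<i> 1] by simp_all
  have "\<exists>s t. 0 < s \<and> s < h \<and> 0 < t \<and> t < h \<and>
      u (z + of_real h * 1 + of_real h * \<i>) - u (z + of_real h * 1) - u (z + of_real h * \<i>) + u z
      = h * h * (Re \<i> * uxx (z + of_real s * 1 + of_real t * \<i>) + Im \<i> * uxy (z + of_real s * 1 + of_real t * \<i>))"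
  proof (rule second_difference_mvt[of h z 1 \<i> S u ux uy uxx uxy])
    show "((\<lambda>w. Re 1 * ux w + Im 1 * uy w) has_derivative (\<lambda>h. Re h * uxx w + Im h * uxy w)) (at w)"
      if "w \<in> S" for w using ux[OF that] by simp
  qed (use S1(1) h(1) u in blast)+
  then obtain s1 t1 where 1: "0 < s1" "s1 < h" "0 < t1" "t1 < h"
    "u (z + of_real h + of_real h * \<i>) - u (z + of_real h) - u (z + of_real h * \<i>) + u z
      = h * h * uxy (z + of_real s1 * 1 + of_real t1 * \<i>)"
    by auto
  have "\<exists>s t. 0 < s \<and> s < h \<and> 0 < t \<and> t < h \<and>
      u (z + of_real h * \<i> + of_real h * 1) - u (z + of_real h * \<i>) - u (z + of_real h * 1) + u z
      = h * h * (Re 1 * uyx (z + of_real s * \<i> + of_real t * 1) + Im 1 * uyy (z + of_real s * \<i> + of_real t * 1))"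
  proof (rule second_difference_mvt[of h z \<i> 1 S u ux uy uyx uyy])
    show "((\<lambda>w. Re \<i> * ux w + Im \<i> * uy w) has_derivative (\<lambda>h. Re h * uyx w + Im h * uyy w)) (at w)"
      if "w \<in> S" for w using uy[OF that] by simp
  qed (use S1(2) h(1) u in blast)+
  then obtain s2 t2 where 2: "0 < s2" "s2 < h" "0 < t2" "t2 < h"
    "u (z + of_real h * \<i> + of_real h) - u (z + of_real h * \<i>) - u (z + of_real h) + u z
      = h * h * uyx (z + of_real s2 * \<i> + of_real t2 * 1)"
    by auto
  define w1 w2 where "w1 = z + of_real s1 * 1 + of_real t1 * \<i>" and "w2 = z + of_real s2 * \<i> + of_real t2 * 1"
  have "h * h * uxy w1 = h * h * uyx w2"
    using 1(5) 2(5) unfolding w1_def w2_def by (simp add: algebra_simps)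
  then have "uxy w1 = uyx w2" using h by simp
  moreover have "dist (uxy w1) (uxy z) < \<epsilon>"
    using near[of s1 t1 1 \<i>] 1 h by (intro d) (auto simp: w1_def)
  moreover have "dist (uyx w2) (uyx z) < \<epsilon>"
    using near[of s2 t2 \<i> 1] 2 h by (intro d) (auto simp: w2_def)
  ultimately show False
    using \<epsilon> by (auto simp: \<epsilon>_def dist_real_def abs_if split: if_splits)
qed

text \<open>The mean value theorem is about real values, so real and imaginary parts are treated
  separately.\<close>

lemma symmetric_second_partials:
  fixes u :: "complex \<Rightarrow> complex"
  assumes "open S" and z: "z \<in> S"
    and u: "\<And>w. w \<in> S \<Longrightarrow> (u has_derivative (\<lambda>h. Re h *\<^sub>R ux w + Im h *\<^sub>R uy w)) (at w)"
    and ux: "\<And>w. w \<in> S \<Longrightarrow> (ux has_derivative (\<lambda>h. Re h *\<^sub>R uxx w + Im h *\<^sub>R uxy w)) (at w)"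
    and uy: "\<And>w. w \<in> S \<Longrightarrow> (uy has_derivative (\<lambda>h. Re h *\<^sub>R uyx w + Im h *\<^sub>R uyy w)) (at w)"
    and c: "continuous_on S uxy" "continuous_on S uyx"
  shows "uxy z = uyx z"
proof (rule complex_eqI)
  show "Re (uxy z) = Re (uyx z)"
    using has_derivative_Re[OF u] has_derivative_Re[OF ux] has_derivative_Re[OF uy]
      continuous_on_Re[OF c(1)] continuous_on_Re[OF c(2)]
    by (intro symmetric_second_partials_real[OF \<open>open S\<close> z, of "\<lambda>z. Re (u z)" "\<lambda>z. Re (ux z)"
          "\<lambda>z. Re (uy z)" "\<lambda>z. Re (uxx z)" "\<lambda>z. Re (uxy z)" "\<lambda>z. Re (uyx z)" "\<lambda>z. Re (uyy z)"]) simp_all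
  show "Im (uxy z) = Im (uyx z)"
    using has_derivative_Im[OF u] has_derivative_Im[OF ux] has_derivative_Im[OF uy]
      continuous_on_Im[OF c(1)] continuous_on_Im[OF c(2)]
    by (intro symmetric_second_partials_real[OF \<open>open S\<close> z, of "\<lambda>z. Im (u z)" "\<lambda>z. Im (ux z)"
          "\<lambda>z. Im (uy z)" "\<lambda>z. Im (uxx z)" "\<lambda>z. Im (uxy z)" "\<lambda>z. Im (uyx z)" "\<lambda>z. Im (uyy z)"]) simp_all
qed

section \<open>Splitting a harmonic function into holomorphic and antiholomorphic parts\<close>

lemma harmonic_onE:
  assumes "harmonic_on u S"
  obtains ux uy uxx uxy uyx uyy where
    "\<And>z. z \<in> S \<Longrightarrow> (u has_derivative (\<lambda>h. Re h *\<^sub>R ux z + Im h *\<^sub>R uy z)) (at z)"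
    "\<And>z. z \<in> S \<Longrightarrow> (ux has_derivative (\<lambda>h. Re h *\<^sub>R uxx z + Im h *\<^sub>R uxy z)) (at z)"
    "\<And>z. z \<in> S \<Longrightarrow> (uy has_derivative (\<lambda>h. Re h *\<^sub>R uyx z + Im h *\<^sub>R uyy z)) (at z)"
    "\<And>z. z \<in> S \<Longrightarrow> uxx z + uyy z = 0"
    "continuous_on S uxx" "continuous_on S uxy" "continuous_on S uyx" "continuous_on S uyy"
  using assms unfolding harmonic_on_def by blast

lemma harmonic_onI:
  assumes "\<And>z. z \<in> S \<Longrightarrow> (u has_derivative (\<lambda>h. Re h *\<^sub>R ux z + Im h *\<^sub>R uy z)) (at z)"
    "\<And>z. z \<in> S \<Longrightarrow> (ux has_derivative (\<lambda>h. Re h *\<^sub>R uxx z + Im h *\<^sub>R uxy z)) (at z)"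
    "\<And>z. z \<in> S \<Longrightarrow> (uy has_derivative (\<lambda>h. Re h *\<^sub>R uyx z + Im h *\<^sub>R uyy z)) (at z)"
    "\<And>z. z \<in> S \<Longrightarrow> uxx z + uyy z = 0"
    "continuous_on S uxx" "continuous_on S uxy" "continuous_on S uyx" "continuous_on S uyy"
  shows "harmonic_on u S"
  unfolding harmonic_on_def using assms by (intro exI conjI ballI)

text \<open>\<open>G\<close> is the Wirtinger derivative of \<open>u\<close> with respect to z. Its
  Cauchy-Riemann equations are the Laplace equation together with the symmetry of the mixed
  partials, so it is holomorphic and has a primitive \<open>f\<close> on the convex set. The
  Wirtinger z-derivative of \<open>u - f\<close> vanishes, so the conjugate of \<open>u - f\<close>
  is holomorphic.\<close>

lemma harmonic_on_decompose:
  assumes "harmonic_on u S" "open S" "convex S"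
  obtains f g where "f holomorphic_on S" "g holomorphic_on S" "\<And>z. z \<in> S \<Longrightarrow> u z = f z + cnj (g z)"
proof -
  obtain ux uy uxx uxy uyx uyy where
    u: "\<And>z. z \<in> S \<Longrightarrow> (u has_derivative (\<lambda>h. Re h *\<^sub>R ux z + Im h *\<^sub>R uy z)) (at z)"
    and ux: "\<And>z. z \<in> S \<Longrightarrow> (ux has_derivative (\<lambda>h. Re h *\<^sub>R uxx z + Im h *\<^sub>R uxy z)) (at z)"
    and uy: "\<And>z. z \<in> S \<Longrightarrow> (uy has_derivative (\<lambda>h. Re h *\<^sub>R uyx z + Im h *\<^sub>R uyy z)) (at z)"
    and lap: "\<And>z. z \<in> S \<Longrightarrow> uxx z + uyy z = 0"
    and "continuous_on S uxx" and c: "continuous_on S uxy" "continuous_on S uyx" and "continuous_on S uyy"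
    using assms(1) unfolding harmonic_on_def by blast
  define G where "G z = (ux z - \<i> * uy z) * (1 / 2)" for z
  have G: "(G has_field_derivative ((uxx z - \<i> * uxy z) / 2)) (at z)" if z: "z \<in> S" for z
  proof -
    have sym: "uyx z = uxy z" using symmetric_second_partials[OF assms(2) z u ux uy c] by simp
    have yy: "uyy z = - uxx z" using lap[OF z] by (simp add: add_eq_0_iff)
    have "(G has_derivative (\<lambda>h. ((Re h *\<^sub>R uxx z + Im h *\<^sub>R uxy z) - \<i> * (Re h *\<^sub>R uyx z + Im h *\<^sub>R uyy z)) * (1 / 2))) (at z)"
      unfolding G_def
      by (intro has_derivative_mult_left has_derivative_diff has_derivative_mult_right ux uy z)
    also have "(\<lambda>h. ((Re h *\<^sub>R uxx z + Im h *\<^sub>R uxy z) - \<i> * (Re h *\<^sub>R uyx z + Im h *\<^sub>R uyy z)) * (1 / 2))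
        = (*) ((uxx z - \<i> * uxy z) / 2)"
      by (intro ext complex_eqI) (simp_all add: sym yy algebra_simps)
    finally show ?thesis by (simp only: has_field_derivative_def)
  qed
  then have "G holomorphic_on S"
    using assms(2) by (subst holomorphic_on_open) blast+
  then obtain f where "\<And>z. z \<in> S \<Longrightarrow> (f has_field_derivative G z) (at z within S)"
    using holomorphic_convex_primitive'[of S G] assms(2,3) by blast
  then have f: "\<And>z. z \<in> S \<Longrightarrow> (f has_field_derivative G z) (at z)"
    using at_within_open[OF _ assms(2)] by metis
  define g where "g z = cnj (u z - f z)" for z
  have g: "(g has_field_derivative cnj ((ux z + \<i> * uy z) / 2)) (at z)" if z: "z \<in> S" for z
  proof -
    have "(f has_derivative (\<lambda>h. G z * h)) (at z)"
      using f[OF z] by (simp add: has_field_derivative_def)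
    then have "(g has_derivative (\<lambda>h. cnj ((Re h *\<^sub>R ux z + Im h *\<^sub>R uy z) - G z * h))) (at z)"
      unfolding g_def
      by (intro has_derivative_cnj has_derivative_diff u z)
    also have "(\<lambda>h. cnj ((Re h *\<^sub>R ux z + Im h *\<^sub>R uy z) - G z * h)) = (*) (cnj ((ux z + \<i> * uy z) / 2))"
      by (intro ext complex_eqI) (simp_all add: G_def field_simps)
    finally show ?thesis by (simp only: has_field_derivative_def)
  qed
  have "f holomorphic_on S" "g holomorphic_on S"
    using f g assms(2) by (subst holomorphic_on_open; blast)+
  then show thesis by (rule that) (simp add: g_def)
qed

section \<open>Radial integrals over the disk\<close>

lemma space_dA [simp]: "space dA = disk"
  by (simp add: dA_def)

lemma sets_dA: "sets dA = sets (lebesgue_on disk)"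
  by (simp add: dA_def)

lemma measurable_dA_eq: "borel_measurable dA = borel_measurable (lebesgue_on disk)"
  by (intro measurable_cong_sets sets_dA refl)

lemma borel_measurable_dA_borel:
  assumes "f \<in> borel_measurable borel" shows "f \<in> borel_measurable dA"
proof -
  have "f \<in> borel_measurable lebesgue"
    using assms by (simp add: borel_measurable_if_D measurable_completion)
  then show ?thesis
    by (simp add: measurable_dA_eq measurable_restrict_space1)
qed

lemma borel_measurable_dA_continuous:
  "continuous_on UNIV f \<Longrightarrow> f \<in> borel_measurable dA"
  by (simp add: borel_measurable_dA_borel borel_measurable_continuous_onI)

lemma emeasure_dA:
  assumes "A \<in> sets lebesgue" "A \<subseteq> disk"
  shows "emeasure dA A = ennreal (1 / pi) * emeasure lebesgue A"
  using assms by (simp add: dA_def emeasure_density_const emeasure_restrict_space sets_restrict_space_iff)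

lemma emeasure_dA_ball:
  assumes "0 \<le> r" "r \<le> 1"
  shows "emeasure dA (ball 0 r) = ennreal (r\<^sup>2)"
  using assms by (subst emeasure_dA) (auto simp: emeasure_ball unit_ball_vol_2 simp flip: ennreal_mult)

lemma emeasure_dA_cball:
  assumes "0 \<le> r" "r < 1"
  shows "emeasure dA (cball 0 r) = ennreal (r\<^sup>2)"
  using assms by (subst emeasure_dA) (auto simp: emeasure_cball unit_ball_vol_2 simp flip: ennreal_mult)

interpretation dA: finite_measure dA
  by standard (use emeasure_dA_ball[of 1] in simp)

lemma AE_dA_nonzero: "AE z in dA. z \<noteq> 0"
proof (rule AE_I')
  have "emeasure dA {0} = 0" by (subst emeasure_dA) simp_all
  then show "{0} \<in> null_sets dA"
    by (auto simp: null_sets_def sets_dA sets_restrict_space_iff)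
qed auto

text \<open>Rotations map the disk to itself, so extension by zero reduces this to Lebesgue measure
  on the plane.\<close>

lemma dA_integral_rotation:
  fixes f :: "complex \<Rightarrow> complex"
  assumes \<omega>: "cmod \<omega> = 1" and f: "f \<in> borel_measurable dA"
  shows "(LINT z|dA. f (\<omega> * z)) = (LINT z|dA. f z)"
    and "(\<lambda>z. f (\<omega> * z)) \<in> borel_measurable dA"
proof -
  define F where "F z = indicator disk z *\<^sub>R f z" for z
  have F: "F \<in> borel_measurable lebesgue"
    using f unfolding F_def measurable_dA_eq by (subst (asm) borel_measurable_restrict_space_iff) simp_all
  have F\<omega>: "F (\<omega> * z) = indicator disk z *\<^sub>R f (\<omega> * z)" for z
    by (simp add: F_def indicator_def norm_mult \<omega>)
  have "(\<lambda>z. F (\<omega> * z)) \<in> borel_measurable lebesgue"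
    using measurable_compose[OF measurable_lebesgue_rotation[OF \<omega>] F] .
  then show f\<omega>: "(\<lambda>z. f (\<omega> * z)) \<in> borel_measurable dA"
    unfolding F\<omega> measurable_dA_eq by (subst borel_measurable_restrict_space_iff) simp_all
  have *: "(LINT z|dA. g z) = (1 / pi) *\<^sub>R (LINT z|lebesgue. indicator disk z *\<^sub>R g z)"
    if "g \<in> borel_measurable dA" for g :: "complex \<Rightarrow> complex"
    using that unfolding dA_def measurable_dA_eq
    by (subst integral_density) (simp_all add: integral_restrict_space)
  show "(LINT z|dA. f (\<omega> * z)) = (LINT z|dA. f z)"
    using lebesgue_integral_rotation[OF \<omega> F] unfolding *[OF f] *[OF f\<omega>] F\<omega> by (simp add: F_def)
qed

text \<open>The square of the modulus is uniformly distributed on [0,1], because a disk of radius r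
  about 0 has normalized area r^2. This takes the place of polar coordinates for radial integrals.
  Upper half-lines suffice for the comparison; for 0 <= x < 1 the set in question is the disk minus
  the closed disk of radius \<open>sqrt x\<close>.\<close>

lemma distr_dA_cmod_square:
  "distr dA borel (\<lambda>z. (cmod z)\<^sup>2) = density lborel (\<lambda>x. ennreal (indicator {0..1} x))" (is "?M = ?N")
proof (rule measure_eqI_lessThan)
  have [measurable]: "(\<lambda>z. (cmod z)\<^sup>2) \<in> borel_measurable dA"
    by (intro borel_measurable_dA_continuous continuous_intros)
  have eqM: "emeasure ?M {x<..} = emeasure dA ({z. x < (cmod z)\<^sup>2} \<inter> disk)" for x
    by (simp add: emeasure_distr vimage_def)
  show "emeasure ?M {x<..} < \<infinity>" for x
    unfolding eqM using dA.emeasure_finite by (metis infinity_ennreal_def less_top)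
  have N: "emeasure ?N {x<..} = emeasure lborel ({x<..} \<inter> {0..1})" for x
    by (simp add: emeasure_density ennreal_indicator Int_commute flip: indicator_inter_arith)
  show "emeasure ?M {x<..} = emeasure ?N {x<..}" for x
  proof -
    consider "x < 0" | "0 \<le> x" "x < 1" | "1 \<le> x" by linarith
    then show ?thesis
    proof cases
      case 1
      have "{z. x < (cmod z)\<^sup>2} \<inter> disk = disk" using 1 by (auto intro: less_le_trans)
      moreover have "{x<..} \<inter> {0..1} = {0..1}" using 1 by auto
      ultimately show ?thesis unfolding eqM N using emeasure_dA_ball[of 1] by simp
    next
      case 2
      have "{z. x < (cmod z)\<^sup>2} \<inter> disk = disk - cball 0 (sqrt x)"
        using 2 by (auto simp: real_sqrt_less_iff not_le real_less_lsqrt real_less_rsqrt)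
           (metis not_less real_sqrt_le_iff real_sqrt_pow2 norm_ge_zero real_sqrt_abs abs_norm_cancel)+
      moreover have "emeasure dA (disk - cball 0 (sqrt x)) = emeasure dA disk - emeasure dA (cball 0 (sqrt x))"
      proof (intro emeasure_Diff)
        have "sqrt x < 1" using 2 by simp
        then have "cmod z < 1" if "cmod z \<le> sqrt x" for z :: complex
          using that by linarith
        then have sub: "cball 0 (sqrt x) \<subseteq> disk" by auto
        then show "cball 0 (sqrt x) \<in> sets dA" "cball 0 (sqrt x) \<subseteq> disk"
          by (auto simp: sets_dA sets_restrict_space_iff)
      qed (auto simp: sets_dA sets_restrict_space_iff)
      moreover have "\<dots> = ennreal (1 - x)"
        using 2 emeasure_dA_ball[of 1] emeasure_dA_cball[of "sqrt x"]
        by (simp add: ennreal_minus flip: ennreal_1)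
      moreover have "{x<..} \<inter> {0..1} = {x<..1}" using 2 by auto
      ultimately show ?thesis unfolding eqM N using 2 by simp
    next
      case 3
      have "{z. x < (cmod z)\<^sup>2} \<inter> disk = {}"
      proof -
        have "(cmod z)\<^sup>2 \<le> 1" if "cmod z < 1" for z :: complex
          using that by (simp add: power_le_one)
        then show ?thesis using 3 by (auto simp: not_less) (meson not_less order_trans)
      qed
      moreover have "{x<..} \<inter> {0..1} = {}" using 3 by auto
      ultimately show ?thesis unfolding eqM N by simp
    qed
  qed
qed simp_all

lemma integral_dA_cmod_square:
  fixes g :: "real \<Rightarrow> real"
  assumes [measurable]: "g \<in> borel_measurable borel"
  shows "(LINT z|dA. g ((cmod z)\<^sup>2)) = (LINT x|lborel. indicator {0..1} x * g x)"
proof -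
  have "(\<lambda>z. (cmod z)\<^sup>2) \<in> borel_measurable dA"
    by (intro borel_measurable_dA_continuous continuous_intros)
  then have "(LINT z|dA. g ((cmod z)\<^sup>2)) = (LINT x|distr dA borel (\<lambda>z. (cmod z)\<^sup>2). g x)"
    by (subst integral_distr) simp_all
  also have "\<dots> = (LINT x|lborel. indicator {0..1} x * g x)"
    unfolding distr_dA_cmod_square by (subst integral_density) simp_all
  finally show ?thesis .
qed

lemma integral_dA_cmod_powr:
  assumes "0 \<le> \<beta>"
  shows "(LINT z|dA. cmod z powr \<beta>) = 2 / (\<beta> + 2)"
proof -
  have hi: "((\<lambda>x. x powr (\<beta> / 2)) has_integral (1 / (\<beta> / 2 + 1))) {0..1}"
    using has_integral_powr_from_0[of "\<beta> / 2" 1] assms by simp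
  have "(LINT z|dA. cmod z powr \<beta>) = (LINT z|dA. ((cmod z)\<^sup>2) powr (\<beta> / 2))"
    by (intro Bochner_Integration.integral_cong) (simp_all add: powr_powr flip: powr_numeral)
  also have "\<dots> = (LINT x|lborel. indicator {0..1} x * x powr (\<beta> / 2))"
    by (rule integral_dA_cmod_square) simp
  also have "\<dots> = 1 / (\<beta> / 2 + 1)"
  proof -
    have "set_integrable lebesgue {0..1} (\<lambda>x::real. x powr (\<beta> / 2))"
      using hi by (intro nonnegative_absolutely_integrable_1) auto
    then have "(LINT x:{0..1}|lebesgue. x powr (\<beta> / 2)) = integral {0..1} (\<lambda>x. x powr (\<beta> / 2))"
      by (intro set_lebesgue_integral_eq_integral)
    then show ?thesis using integral_unique[OF hi]
      by (simp add: set_lebesgue_integral_def integral_completion)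
  qed
  finally show ?thesis using assms by (simp add: field_simps)
qed

lemma integral_dA_cmod_power_powr:
  assumes "0 \<le> \<beta>"
  shows "(LINT z|dA. cmod z ^ n * cmod z powr \<beta>) = 2 / (real n + \<beta> + 2)"
proof -
  have "(LINT z|dA. cmod z ^ n * cmod z powr \<beta>) = (LINT z|dA. cmod z powr (real n + \<beta>))"
  proof (intro Bochner_Integration.integral_cong refl)
    show "cmod z ^ n * cmod z powr \<beta> = cmod z powr (real n + \<beta>)" for z
      by (cases "z = 0") (simp_all add: powr_add powr_realpow)
  qed
  then show ?thesis using assms by (simp add: integral_dA_cmod_powr)
qed

lemma integral_dA_cmod_power: "(LINT z|dA. cmod z ^ n) = 2 / (real n + 2)"
proof -
  have "(LINT z|dA. cmod z ^ n) = (LINT z|dA. cmod z ^ n * cmod z powr 0)"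
  proof (intro integral_cong_AE borel_measurable_dA_borel)
    \<comment> \<open>Since \<open>0 powr 0\<close> is 0, the integrands differ at the origin when
      \<open>n = 0\<close>, so they agree only almost everywhere.\<close>
    show "AE z in dA. cmod z ^ n = cmod z ^ n * cmod z powr 0"
      using AE_dA_nonzero by eventually_elim simp
  qed simp_all
  also have "\<dots> = 2 / (real n + 2)"
    using integral_dA_cmod_power_powr[of 0 n] by (simp only: add_0_right order_refl)
  finally show ?thesis .
qed

lemma integrable_dA_bounded:
  fixes f :: "complex \<Rightarrow> 'a::{banach,second_countable_topology}"
  assumes "f \<in> borel_measurable dA" "\<And>z. z \<in> disk \<Longrightarrow> norm (f z) \<le> B"
  shows "integrable dA f"
  using assms by (intro dA.integrable_const_bound[where B = B]) auto

section \<open>The moment problem for radial functions\<close>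

text \<open>By Weierstrass, \<open>q\<close> is uniformly close on [0,1] to a polynomial; composed
  with the squared modulus, that polynomial pairs with \<open>h\<close> as a finite combination of
  the vanishing moments.\<close>

lemma radial_moments_continuous:
  fixes h :: "complex \<Rightarrow> real" and q :: "real \<Rightarrow> real"
  assumes h: "h \<in> borel_measurable dA" and B: "\<And>z. z \<in> disk \<Longrightarrow> \<bar>h z\<bar> \<le> B"
    and mom: "\<And>j. (LINT z|dA. h z * ((cmod z)\<^sup>2) ^ j) = 0"
    and q: "continuous_on UNIV q"
  shows "(LINT z|dA. h z * q ((cmod z)\<^sup>2)) = 0"
proof (rule ccontr)
  define c where "c = \<bar>LINT z|dA. h z * q ((cmod z)\<^sup>2)\<bar>"
  assume "\<not> ?thesis"
  then have c: "c > 0" by (simp add: c_def)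
  have B0: "0 \<le> B" using B[of 0] by simp
  \<comment> \<open>The factor 2 makes the final bound \<open>B * e\<close> smaller than
    \<open>c\<close>; \<open>B + 1\<close> keeps the denominator positive when \<open>B\<close> is
    0.\<close>
  define e where "e = c / (2 * (B + 1))"
  have e: "e > 0" using c B0 by (simp add: e_def)
  obtain g where "real_polynomial_function g" and g: "\<And>x. x \<in> {0..1} \<Longrightarrow> \<bar>q x - g x\<bar> < e"
    using Stone_Weierstrass_real_polynomial_function[of "{0..1}" q e] e q
    by (metis compact_Icc continuous_on_subset subset_UNIV)
  then obtain a n where ga: "g = (\<lambda>x. \<Sum>i\<le>n. a i * x ^ i)"
    using real_polynomial_function_iff_sum by blast
  have bd: "integrable dA (\<lambda>z. h z * k ((cmod z)\<^sup>2))" if k: "continuous_on UNIV k" for k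
  proof -
    have "bounded (k ` {0..1})"
      by (intro compact_imp_bounded compact_continuous_image continuous_on_subset[OF k]) auto
    then obtain K where K: "\<And>x. x \<in> {0..1} \<Longrightarrow> \<bar>k x\<bar> \<le> K"
      unfolding bounded_iff by (metis imageI real_norm_def)
    have "continuous_on UNIV (\<lambda>z::complex. k ((cmod z)\<^sup>2))"
      by (intro continuous_on_compose2[OF k] continuous_intros) auto
    then show ?thesis
    proof (intro integrable_dA_bounded[where B = "B * K"] borel_measurable_times h borel_measurable_dA_continuous)
      fix z :: complex assume z: "z \<in> disk"
      then have "(cmod z)\<^sup>2 \<in> {0..1}" by (simp add: power_le_one)
      then show "norm (h z * k ((cmod z)\<^sup>2)) \<le> B * K"
        using B[OF z] K by (auto simp: abs_mult intro!: mult_mono B0)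
    qed
  qed
  have gc: "continuous_on UNIV g" unfolding ga by (intro continuous_intros)
  have "(LINT z|dA. h z * g ((cmod z)\<^sup>2)) = (LINT z|dA. (\<Sum>i\<le>n. a i * (h z * ((cmod z)\<^sup>2) ^ i)))"
    by (simp add: ga sum_distrib_left algebra_simps)
  also have "\<dots> = (\<Sum>i\<le>n. LINT z|dA. a i * (h z * ((cmod z)\<^sup>2) ^ i))"
    by (intro Bochner_Integration.integral_sum integrable_mult_right bd continuous_intros)
  also have "\<dots> = 0" using mom by simp
  finally have g0: "(LINT z|dA. h z * g ((cmod z)\<^sup>2)) = 0" .
  have "(LINT z|dA. h z * q ((cmod z)\<^sup>2)) = (LINT z|dA. h z * q ((cmod z)\<^sup>2) - h z * g ((cmod z)\<^sup>2))"
    by (simp add: bd q gc g0)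
  then have "c = norm (LINT z|dA. h z * (\<lambda>x. q x - g x) ((cmod z)\<^sup>2))"
    by (simp add: c_def algebra_simps)
  also have "\<dots> \<le> (LINT z|dA. B * e)"
  proof (rule Bochner_Integration.integral_norm_bound_integral)
    show "integrable dA (\<lambda>z. h z * (\<lambda>x. q x - g x) ((cmod z)\<^sup>2))"
      by (intro bd continuous_on_diff q gc)
    show "integrable dA (\<lambda>z. B * e)" by (intro integrable_dA_bounded) auto
    fix z assume "z \<in> space dA"
    then have z: "z \<in> disk" by simp
    then have "(cmod z)\<^sup>2 \<in> {0..1}" by (simp add: power_le_one)
    then show "norm (h z * (\<lambda>x. q x - g x) ((cmod z)\<^sup>2)) \<le> B * e"
      using B[OF z] g[of "(cmod z)\<^sup>2"] by (auto simp: abs_mult intro!: mult_mono B0)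
  qed
  also have "\<dots> = B * e" using emeasure_dA_ball[of 1] by (simp add: measure_def)
  also have "\<dots> < c"
    using c B0 by (simp add: e_def field_simps add_nonneg_pos)
  finally show False by simp
qed

text \<open>If \<open>h\<close> were positive on a set of positive measure, there would be a compact
  non-null \<open>T\<close> inside that set. The indicator of the radial hull of \<open>T\<close> is
  a bounded limit of continuous functions of the squared modulus, so \<open>h\<close> has integral
  zero over the hull, although it is positive there.\<close>

lemma radial_moments_nonpos:
  fixes h :: "complex \<Rightarrow> real"
  assumes h: "h \<in> borel_measurable dA" and B: "\<And>z. z \<in> disk \<Longrightarrow> \<bar>h z\<bar> \<le> B"
    and rad: "\<And>z w. z \<in> disk \<Longrightarrow> w \<in> disk \<Longrightarrow> cmod z = cmod w \<Longrightarrow> h z = h w"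
    and mom: "\<And>j. (LINT z|dA. h z * ((cmod z)\<^sup>2) ^ j) = 0"
  shows "AE z in dA. h z \<le> 0"
proof -
  define E where "E = {z \<in> disk. h z > 0}"
  have "E \<in> sets dA" using h unfolding E_def by (metis borel_measurable_iff_greater space_dA)
  then have E: "E \<in> sets lebesgue" "E \<subseteq> disk"
    by (auto simp: sets_dA sets_restrict_space_iff)
  have "emeasure lebesgue E = 0"
  proof (rule ccontr)
    assume pos: "emeasure lebesgue E \<noteq> 0"
    have "E \<in> lmeasurable"
      using E by (meson bounded_ball bounded_subset bounded_set_imp_lmeasurable)
    then have em: "emeasure lebesgue E = ennreal (measure lebesgue E)" "measure lebesgue E > 0"
      using pos by (auto simp: emeasure_eq_measure2 zero_less_measure_iff)
    \<comment> \<open>Inner regularity with the measure of \<open>E\<close> itself as tolerance: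
      this is what prevents \<open>T\<close> from being null.\<close>
    obtain T where T: "closed T" "T \<subseteq> E" and ET: "emeasure lebesgue (E - T) < ennreal (measure lebesgue E)"
      using sets_lebesgue_inner_closed[OF E(1) em(2)] by metis
    have Tpos: "emeasure lebesgue T \<noteq> 0"
    proof
      assume "emeasure lebesgue T = 0"
      then have "emeasure lebesgue (E - T) = emeasure lebesgue E"
        using E T by (intro emeasure_Diff_null_set) (auto simp: null_sets_def)
      then show False using ET em by simp
    qed
    then have Tne: "T \<noteq> {}" by auto
    have "compact T"
      using T E by (meson bounded_ball bounded_subset compact_eq_bounded_closed)
    \<comment> \<open>Lebesgue measurability of a radial set says nothing directly about its set of radii, so \<open>T\<close> is
      replaced by its radial hull \<open>K\<close>, which is still contained in the radial set \<open>E\<close>.\<close>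
    define D where "D = (\<lambda>z. (cmod z)\<^sup>2) ` T"
    have D: "closed D" "D \<noteq> {}"
      using \<open>compact T\<close> Tne unfolding D_def
      by (auto intro!: compact_imp_closed compact_continuous_image continuous_intros)
    define K where "K = {z. (cmod z)\<^sup>2 \<in> D}"
    have KE: "z \<in> E" if "z \<in> K" for z
    proof -
      have "(cmod z)\<^sup>2 \<in> (\<lambda>z. (cmod z)\<^sup>2) ` T" using that by (simp add: K_def D_def)
      then obtain w where "w \<in> T" "(cmod z)\<^sup>2 = (cmod w)\<^sup>2" by (rule imageE)
      then have w: "w \<in> E" "cmod z = cmod w" using T by auto
      then have "z \<in> disk" by (simp add: E_def)
      then show ?thesis using w rad[of z w] by (auto simp: E_def)
    qed
    \<comment> \<open>Continuous cutoffs that are 1 on \<open>D\<close> and 0 at distance at least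
      1/n from it. Off the closed nonempty set \<open>D\<close> the distance is positive, so they
      converge pointwise to the indicator of \<open>D\<close>.\<close>
    define q where "q n x = max 0 (1 - real n * infdist x D)" for n x
    have qc: "continuous_on UNIV (q n)" for n
      unfolding q_def by (intro continuous_intros)
    have q01: "0 \<le> q n x" "q n x \<le> 1" for n x
      by (auto simp: q_def infdist_nonneg)
    have lim: "(\<lambda>n. q n x) \<longlonglongrightarrow> indicator D x" for x
    proof (cases "x \<in> D")
      case True
      then have "q n x = 1" for n by (simp add: q_def)
      then show ?thesis using True by simp
    next
      case False
      then have d: "infdist x D > 0" using D by (simp add: infdist_pos_not_in_closed)
      obtain N :: nat where N: "1 / infdist x D < real N" using reals_Archimedean2 by blast
      have "q n x = 0" if "n \<ge> N" for n
      proof -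
        have "1 < real N * infdist x D" using N d by (simp add: field_simps)
        also have "\<dots> \<le> real n * infdist x D" using that d by (intro mult_right_mono) auto
        finally show ?thesis by (simp add: q_def)
      qed
      then have "eventually (\<lambda>n. q n x = 0) sequentially"
        using eventually_sequentially by blast
      then show ?thesis using False by (simp add: tendsto_eventually)
    qed
    have qm: "(\<lambda>z. q n ((cmod z)\<^sup>2)) \<in> borel_measurable dA" for n
      by (intro borel_measurable_dA_continuous continuous_on_compose2[OF qc] continuous_intros) auto
    have "closed K"
    proof -
      have "closed ((\<lambda>z::complex. (cmod z)\<^sup>2) -` D)"
        by (intro closed_vimage D continuous_intros)
      then show ?thesis by (simp add: K_def vimage_def)
    qed
    then have km: "(\<lambda>z. indicator D ((cmod z)\<^sup>2) :: real) \<in> borel_measurable dA"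
    proof -
      have "(\<lambda>z. indicator D ((cmod z)\<^sup>2) :: real) = indicator K"
        by (auto simp: K_def indicator_def fun_eq_iff)
      then show ?thesis using \<open>closed K\<close> by (simp add: borel_measurable_dA_borel)
    qed
    have "(\<lambda>n. LINT z|dA. h z * q n ((cmod z)\<^sup>2)) \<longlonglongrightarrow> (LINT z|dA. h z * indicator D ((cmod z)\<^sup>2))"
    proof (rule integral_dominated_convergence[where w = "\<lambda>_. B"])
      show "integrable dA (\<lambda>_. B)" by (intro integrable_dA_bounded) auto
      show "AE z in dA. (\<lambda>n. h z * q n ((cmod z)\<^sup>2)) \<longlonglongrightarrow> h z * indicator D ((cmod z)\<^sup>2)"
        by (intro AE_I2 tendsto_mult tendsto_const lim)
      show "AE z in dA. norm (h z * q n ((cmod z)\<^sup>2)) \<le> B" for n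
      proof (rule AE_I2)
        fix z assume "z \<in> space dA"
        then show "norm (h z * q n ((cmod z)\<^sup>2)) \<le> B"
          using B[of z] q01[of n "(cmod z)\<^sup>2"] mult_mono[of "\<bar>h z\<bar>" B "q n ((cmod z)\<^sup>2)" 1]
          by (auto simp: abs_mult)
      qed
    qed (intro borel_measurable_times h qm km)+
    then have int0: "(LINT z|dA. h z * indicator D ((cmod z)\<^sup>2)) = 0"
      using radial_moments_continuous[OF h B mom qc] by (simp add: LIMSEQ_const_iff)
    have nn: "0 \<le> h z * indicator D ((cmod z)\<^sup>2)" for z
      using KE[of z] by (auto simp: K_def E_def indicator_def)
    have "integrable dA (\<lambda>z. h z * indicator D ((cmod z)\<^sup>2))"
      using B order_trans[OF abs_ge_zero B]
      by (intro integrable_dA_bounded[where B = B] borel_measurable_times h km) (auto simp: indicator_def)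
    then have "AE z in dA. h z * indicator D ((cmod z)\<^sup>2) = 0"
      using int0 nn by (subst (asm) integral_nonneg_eq_0_iff_AE) auto
    \<comment> \<open>On \<open>T\<close> the indicator is 1 and \<open>h\<close> is positive, so
      the product cannot vanish there.\<close>
    then have "AE z in dA. z \<notin> T"
    proof eventually_elim
      case (elim z)
      show ?case
      proof
        assume "z \<in> T"
        then have "z \<in> E" "(cmod z)\<^sup>2 \<in> D" using T by (auto simp: D_def)
        then show False using elim by (simp add: E_def)
      qed
    qed
    moreover have TdA: "T \<in> sets dA" using T E by (auto simp: sets_dA sets_restrict_space_iff)
    ultimately have "emeasure dA T = 0"
      using T E by (subst (asm) AE_iff_measurable[of T]) auto
    then have "emeasure lebesgue T = 0"
      using T E by (subst (asm) emeasure_dA) auto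
    then show False using Tpos by simp
  qed
  then have "emeasure dA E = 0" using E by (subst emeasure_dA) auto
  then show ?thesis
    using \<open>E \<in> sets dA\<close> by (intro AE_I[where N = E]) (auto simp: E_def)
qed

lemma radial_moments_zero:
  fixes h :: "complex \<Rightarrow> complex"
  assumes h: "h \<in> borel_measurable dA" and B: "bounded (h ` disk)"
    and rad: "radial h"
    and mom: "\<And>j. (LINT z|dA. h z * of_real (((cmod z)\<^sup>2) ^ j)) = 0"
  shows "AE z in dA. h z = 0"
proof -
  obtain B where B: "\<And>z. z \<in> disk \<Longrightarrow> cmod (h z) \<le> B"
    using assms(2) unfolding bounded_iff by (metis imageI)
  have int: "integrable dA (\<lambda>z. h z * of_real (((cmod z)\<^sup>2) ^ j))" for j
  proof (intro integrable_dA_bounded[where B = B] borel_measurable_times h borel_measurable_dA_continuous continuous_intros)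
    fix z :: complex assume z: "z \<in> disk"
    then have "((cmod z)\<^sup>2) ^ j \<le> 1" by (simp add: power_le_one)
    then show "norm (h z * of_real (((cmod z)\<^sup>2) ^ j)) \<le> B"
      using B[OF z] mult_mono[of "cmod (h z)" B "((cmod z)\<^sup>2) ^ j" 1] order_trans[OF norm_ge_zero B[OF z]]
      by (simp add: norm_mult norm_power)
  qed
  \<comment> \<open>Stated for every real-linear functional bounded by the modulus, so that
    \<open>Re\<close>, \<open>Im\<close> and their negatives share one argument.\<close>
  have part: "AE z in dA. f (h z) \<le> 0"
    if f: "bounded_linear f" and f1: "\<And>w. \<bar>f w\<bar> \<le> cmod w" for f :: "complex \<Rightarrow> real"
  proof (rule radial_moments_nonpos)
    show "(\<lambda>z. f (h z)) \<in> borel_measurable dA"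
      using measurable_compose[OF h borel_measurable_continuous_onI[OF linear_continuous_on[OF f]]] .
    show "\<bar>f (h z)\<bar> \<le> B" if "z \<in> disk" for z
      using f1 B[OF that] by (rule order_trans)
    show "f (h z) = f (h w)" if "z \<in> disk" "w \<in> disk" "cmod z = cmod w" for z w
    proof -
      have "h z = h w" using rad that unfolding radial_def by blast
      then show ?thesis by simp
    qed
    have "f (h z * of_real r) = f (h z) * r" for z r
      using linear_scale[OF bounded_linear.linear[OF f], of r "h z"]
      by (simp add: scaleR_conv_of_real mult.commute)
    then show "(LINT z|dA. f (h z) * ((cmod z)\<^sup>2) ^ j) = 0" for j
      using integral_bounded_linear[OF f int[of j]] mom[of j] linear_0[OF bounded_linear.linear[OF f]]
      by (simp del: of_real_power)
  qed
  have "AE z in dA. Re (h z) \<le> 0" "AE z in dA. Im (h z) \<le> 0"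
    by (rule part[OF bounded_linear_Re abs_Re_le_cmod], rule part[OF bounded_linear_Im abs_Im_le_cmod])
  moreover have "AE z in dA. - Re (h z) \<le> 0" "AE z in dA. - Im (h z) \<le> 0"
    by (rule part[OF bounded_linear_minus[OF bounded_linear_Re]], simp add: abs_Re_le_cmod,
        rule part[OF bounded_linear_minus[OF bounded_linear_Im]], simp add: abs_Im_le_cmod)
  ultimately show ?thesis
    by eventually_elim (simp add: complex_eq_iff)
qed

section \<open>The harmonic Bergman space\<close>

text \<open>The harmonic extension to the disk of the character exp(ik theta) of the unit
  circle.\<close>

definition harmonic_monomial :: "int \<Rightarrow> complex \<Rightarrow> complex" where
  "harmonic_monomial k z = (if 0 \<le> k then z ^ nat k else cnj z ^ nat (- k))"

lemma cmod_harmonic_monomial: "cmod (harmonic_monomial k z) = cmod z ^ nat \<bar>k\<bar>"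
  by (simp add: harmonic_monomial_def norm_power)

lemma continuous_on_harmonic_monomial: "continuous_on UNIV (harmonic_monomial k)"
  unfolding harmonic_monomial_def by (cases "0 \<le> k") (auto intro!: continuous_intros)

lemma harmonic_monomial_measurable: "harmonic_monomial k \<in> borel_measurable dA"
  by (intro borel_measurable_dA_continuous continuous_on_harmonic_monomial)

lemma cmod_harmonic_monomial_le: "z \<in> disk \<Longrightarrow> cmod (harmonic_monomial k z) \<le> 1"
  by (simp add: cmod_harmonic_monomial power_le_one)

lemma cnj_unit: "cmod \<omega> = 1 \<Longrightarrow> cnj \<omega> = inverse \<omega>"
  by (metis complex_norm_square inverse_unique mult.commute of_real_1 power_one)

lemma harmonic_monomial_rotate:
  assumes "cmod \<omega> = 1" shows "harmonic_monomial k (\<omega> * z) = \<omega> powi k * harmonic_monomial k z"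
  by (simp add: harmonic_monomial_def power_mult_distrib cnj_unit[OF assms] power_int_def)

text \<open>Rotation of the positive number \<open>cmod z\<close> by the unit \<open>sgn z\<close>:
  angle and modulus are separated without choosing an argument.\<close>

lemma harmonic_monomial_polar:
  assumes "z \<noteq> 0" shows "harmonic_monomial k z = sgn z powi k * of_real (cmod z ^ nat \<bar>k\<bar>)"
proof -
  have "harmonic_monomial k z = harmonic_monomial k (sgn z * of_real (cmod z))"
    using assms by (simp add: sgn_eq)
  also have "\<dots> = sgn z powi k * of_real (cmod z ^ nat \<bar>k\<bar>)"
    using assms by (subst harmonic_monomial_rotate) (auto simp: norm_sgn harmonic_monomial_def)
  finally show ?thesis .
qed

lemma harmonic_monomial_mult_cnj_self: "harmonic_monomial k z * cnj (harmonic_monomial k z) = of_real (cmod z ^ (2 * nat \<bar>k\<bar>))"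
  by (simp add: complex_norm_square[symmetric] cmod_harmonic_monomial power_mult[symmetric] mult.commute)

text \<open>The partial derivatives of a holomorphic f are f' and i f', so its Laplacian is f'' +
  i^2 f'' = 0.\<close>

lemma holomorphic_imp_harmonic_on:
  assumes "f holomorphic_on S" "open S"
  shows "harmonic_on f S"
proof -
  define f1 f2 where "f1 = deriv f" and "f2 = deriv f1"
  have h: "f1 holomorphic_on S" "f2 holomorphic_on S"
    using assms by (auto simp: f1_def f2_def intro!: holomorphic_deriv)
  have D: "(f has_field_derivative f1 z) (at z)" "(f1 has_field_derivative f2 z) (at z)" if "z \<in> S" for z
    using holomorphic_derivI[OF assms that] holomorphic_derivI[OF h(1) assms(2) that]
    by (auto simp: f1_def f2_def)
  have frechet: "(g has_derivative (\<lambda>h. Re h *\<^sub>R g' + Im h *\<^sub>R (\<i> * g'))) (at z)"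
    if "(g has_field_derivative g') (at z)" for g g' z
  proof -
    have "(g has_derivative (*) g') (at z)" using that by (simp add: has_field_derivative_def)
    then show ?thesis
      by (rule has_derivative_eq_rhs) (auto simp: fun_eq_iff complex_eq_iff algebra_simps)
  qed
  have c: "continuous_on S f2" by (rule holomorphic_on_imp_continuous_on) fact
  show ?thesis
    unfolding harmonic_on_def
  proof (intro exI conjI ballI)
    fix z assume z: "z \<in> S"
    show "(f has_derivative (\<lambda>h. Re h *\<^sub>R f1 z + Im h *\<^sub>R (\<i> * f1 z))) (at z)"
      "(f1 has_derivative (\<lambda>h. Re h *\<^sub>R f2 z + Im h *\<^sub>R (\<i> * f2 z))) (at z)"
      by (intro frechet D z)+
    show "((\<lambda>z. \<i> * f1 z) has_derivative (\<lambda>h. Re h *\<^sub>R (\<i> * f2 z) + Im h *\<^sub>R (- f2 z))) (at z)"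
      using frechet[OF DERIV_cmult[OF D(2)[OF z], of \<i>]] by (simp add: mult.assoc[symmetric])
    show "f2 z + - f2 z = 0" by simp
  qed (intro c continuous_intros)+
qed

lemma harmonic_on_cnj:
  assumes "harmonic_on u S" shows "harmonic_on (\<lambda>z. cnj (u z)) S"
  using assms
proof (rule harmonic_onE, goal_cases)
  case (1 ux uy uxx uxy uyx uyy)
  have d: "((\<lambda>z. cnj (g z)) has_derivative (\<lambda>h. Re h *\<^sub>R cnj a + Im h *\<^sub>R cnj b)) (at z)"
    if "(g has_derivative (\<lambda>h. Re h *\<^sub>R a + Im h *\<^sub>R b)) (at z)" for g a b z
    using has_derivative_cnj[OF that] by simp
  have lap: "cnj (uxx z) + cnj (uyy z) = 0" if "z \<in> S" for z
    using 1(4)[OF that] by (metis complex_cnj_add complex_cnj_zero)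
  show ?case
    by (rule harmonic_onI[where ux = "\<lambda>z. cnj (ux z)" and uy = "\<lambda>z. cnj (uy z)"
          and uxx = "\<lambda>z. cnj (uxx z)" and uxy = "\<lambda>z. cnj (uxy z)"
          and uyx = "\<lambda>z. cnj (uyx z)" and uyy = "\<lambda>z. cnj (uyy z)"])
      (intro d 1 lap continuous_on_cnj; assumption)+
qed

lemma harmonic_on_diff:
  assumes "harmonic_on u S" "harmonic_on v S" shows "harmonic_on (\<lambda>z. u z - v z) S"
  using assms(1)
proof (rule harmonic_onE, goal_cases)
  case u: (1 ux uy uxx uxy uyx uyy)
  show ?case
    using assms(2)
  proof (rule harmonic_onE, goal_cases)
    case v: (1 vx vy vxx vxy vyx vyy)
    have d: "((\<lambda>z. g z - k z) has_derivative (\<lambda>h. Re h *\<^sub>R (a - a') + Im h *\<^sub>R (b - b'))) (at z)"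
      if "(g has_derivative (\<lambda>h. Re h *\<^sub>R a + Im h *\<^sub>R b)) (at z)"
        "(k has_derivative (\<lambda>h. Re h *\<^sub>R a' + Im h *\<^sub>R b')) (at z)"
      for g k :: "complex \<Rightarrow> complex" and a b a' b' z
      using has_derivative_diff[OF that]
      by (rule has_derivative_eq_rhs) (simp add: fun_eq_iff algebra_simps)
    have lap: "uxx z - vxx z + (uyy z - vyy z) = 0" if "z \<in> S" for z
    proof -
      have "uxx z - vxx z + (uyy z - vyy z) = (uxx z + uyy z) - (vxx z + vyy z)" by simp
      then show ?thesis using u(4)[OF that] v(4)[OF that] by simp
    qed
    show ?case
      by (rule harmonic_onI[where ux = "\<lambda>z. ux z - vx z" and uy = "\<lambda>z. uy z - vy z"
            and uxx = "\<lambda>z. uxx z - vxx z" and uxy = "\<lambda>z. uxy z - vxy z"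
            and uyx = "\<lambda>z. uyx z - vyx z" and uyy = "\<lambda>z. uyy z - vyy z"])
        (intro d u v lap continuous_on_diff; assumption)+
  qed
qed

lemma harmonic_on_imp_continuous_on:
  assumes "harmonic_on u S" shows "continuous_on S u"
  using assms
proof (rule harmonic_onE, goal_cases)
  case 1
  show ?case
    by (intro continuous_at_imp_continuous_on ballI) (rule has_derivative_continuous[OF 1(1)])
qed

section \<open>Square-integrable functions and the orthogonal projection\<close>

lemma L2_diff:
  assumes "u \<in> L2" "v \<in> L2" shows "(\<lambda>z. u z - v z) \<in> L2"
proof -
  have m: "u \<in> borel_measurable dA" "v \<in> borel_measurable dA"
    and i: "integrable dA (\<lambda>z. 2 * (cmod (u z))\<^sup>2 + 2 * (cmod (v z))\<^sup>2)"
    using assms by (auto simp: L2_def)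
  have "(cmod (a - b))\<^sup>2 \<le> 2 * (cmod a)\<^sup>2 + 2 * (cmod b)\<^sup>2" for a b :: complex
  proof -
    have "(cmod (a - b))\<^sup>2 \<le> (cmod a + cmod b)\<^sup>2"
      by (intro power_mono norm_triangle_ineq4) auto
    also have "\<dots> \<le> 2 * (cmod a)\<^sup>2 + 2 * (cmod b)\<^sup>2"
      using sum_squares_bound[of "cmod a" "cmod b"] by (simp add: power2_sum)
    finally show ?thesis .
  qed
  then have "integrable dA (\<lambda>z. (cmod (u z - v z))\<^sup>2)"
    using m by (intro Bochner_Integration.integrable_bound[OF i]) auto
  then show ?thesis using m by (simp add: L2_def)
qed

lemma L2_inner_integrable:
  assumes "u \<in> L2" "v \<in> L2" shows "integrable dA (\<lambda>z. u z * cnj (v z))"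
proof -
  have m: "u \<in> borel_measurable dA" "v \<in> borel_measurable dA"
    and i: "integrable dA (\<lambda>z. (cmod (u z))\<^sup>2 + (cmod (v z))\<^sup>2)"
    using assms by (auto simp: L2_def)
  have "cmod (a * cnj b) \<le> (cmod a)\<^sup>2 + (cmod b)\<^sup>2" for a b :: complex
  proof -
    have "0 \<le> cmod a * cmod b" by simp
    then show ?thesis using sum_squares_bound[of "cmod a" "cmod b"] by (simp only: norm_mult complex_mod_cnj)
  qed
  then show ?thesis
    using m by (intro Bochner_Integration.integrable_bound[OF i])
      (auto intro!: borel_measurable_times borel_measurable_continuous_on[OF continuous_on_cnj[OF continuous_on_id]])
qed

lemma L2_bounded:
  assumes "f \<in> borel_measurable dA" "\<And>z. z \<in> disk \<Longrightarrow> cmod (f z) \<le> B"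
  shows "f \<in> L2"
proof -
  have "integrable dA (\<lambda>z. (cmod (f z))\<^sup>2)"
    using assms by (intro integrable_dA_bounded[where B = "B\<^sup>2"]) (auto intro: power_mono)
  then show ?thesis using assms(1) by (simp add: L2_def)
qed

lemma harmonic_Bergman_harmonic_monomial: "(\<lambda>z. c * harmonic_monomial k z) \<in> harmonic_Bergman"
proof -
  have "(\<lambda>z. c * harmonic_monomial k z) \<in> L2"
  proof (rule L2_bounded[where B = "cmod c"])
    show "(\<lambda>z. c * harmonic_monomial k z) \<in> borel_measurable dA"
      by (intro borel_measurable_times harmonic_monomial_measurable) auto
    show "cmod (c * harmonic_monomial k z) \<le> cmod c" if "z \<in> disk" for z
      using cmod_harmonic_monomial_le[OF that, of k] by (simp add: norm_mult mult_left_le)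
  qed
  moreover have "harmonic_on (\<lambda>z. c * harmonic_monomial k z) disk"
  proof (cases "0 \<le> k")
    case True
    then show ?thesis
      unfolding harmonic_monomial_def by (auto intro!: holomorphic_imp_harmonic_on holomorphic_intros)
  next
    case False
    have "harmonic_on (\<lambda>z. cnj (cnj c * z ^ nat (- k))) disk"
      by (intro harmonic_on_cnj holomorphic_imp_harmonic_on holomorphic_intros) auto
    then show ?thesis using False by (simp add: harmonic_monomial_def)
  qed
  ultimately show ?thesis by (simp add: harmonic_Bergman_def)
qed

lemma harmonic_Bergman_diff:
  "u \<in> harmonic_Bergman \<Longrightarrow> v \<in> harmonic_Bergman \<Longrightarrow> (\<lambda>z. u z - v z) \<in> harmonic_Bergman"
  by (simp add: harmonic_Bergman_def L2_diff harmonic_on_diff)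

text \<open>Norm zero gives vanishing almost everywhere only. By continuity the set where
  \<open>u\<close> is nonzero is open, and a null open set is empty.\<close>

lemma harmonic_Bergman_eq_zero:
  assumes u: "u \<in> harmonic_Bergman" and 0: "L2_inner u u = 0" and z: "z \<in> disk"
  shows "u z = 0"
proof (rule ccontr)
  assume nz: "u z \<noteq> 0"
  have "integrable dA (\<lambda>z. (cmod (u z))\<^sup>2)"
    using u by (simp add: harmonic_Bergman_def L2_def)
  moreover have "(LINT z|dA. (cmod (u z))\<^sup>2) = 0"
    using 0 by (simp add: L2_inner_def complex_norm_square[symmetric] del: of_real_power)
  ultimately have ae: "AE z in dA. u z = 0"
    by (subst (asm) integral_nonneg_eq_0_iff_AE) auto
  have c: "continuous_on disk u"
    using u by (simp add: harmonic_Bergman_def harmonic_on_imp_continuous_on)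
  define W where "W = {w \<in> disk. u w \<noteq> 0}"
  have "open W"
  proof -
    have "W = disk \<inter> u -` (- {0})" by (auto simp: W_def)
    then show ?thesis using continuous_open_preimage[OF c, of "- {0}"] by auto
  qed
  moreover have "emeasure lebesgue W = 0"
  proof -
    have "W \<in> sets dA" using \<open>open W\<close> by (auto simp: W_def sets_dA sets_restrict_space_iff)
    then have "emeasure dA W = 0"
      using ae by (subst (asm) AE_iff_measurable[of W]) (auto simp: W_def)
    then show ?thesis using \<open>open W\<close> by (subst (asm) emeasure_dA) (auto simp: W_def)
  qed
  ultimately have "W = {}"
    using open_not_negligible[of W] by (auto simp: negligible_iff_null_sets null_sets_def)
  then show False using z nz by (auto simp: W_def)
qed

text \<open>The given \<open>u\<close> is a witness for the choice in \<open>Q\<close>, so the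
  chosen function also satisfies the defining condition. The difference of the two lies in the space
  and is orthogonal to itself, hence is zero on the disk.\<close>

lemma Q_eqI:
  assumes f: "f \<in> L2" and u: "u \<in> harmonic_Bergman"
    and orth: "\<And>v. v \<in> harmonic_Bergman \<Longrightarrow> L2_inner (\<lambda>z. f z - u z) v = 0"
    and z: "z \<in> disk"
  shows "Q f z = u z"
proof -
  let ?P = "\<lambda>u. u \<in> harmonic_Bergman \<and> (\<forall>v\<in>harmonic_Bergman. L2_inner (\<lambda>z. f z - u z) v = 0)"
  define w where "w = Q f"
  have "?P w" unfolding w_def Q_def using u orth by (intro someI[of ?P u]) auto
  then have w: "w \<in> harmonic_Bergman" and worth: "\<And>v. v \<in> harmonic_Bergman \<Longrightarrow> L2_inner (\<lambda>z. f z - w z) v = 0"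
    by auto
  define d where "d z = w z - u z" for z
  have d: "d \<in> harmonic_Bergman" unfolding d_def using w u by (rule harmonic_Bergman_diff)
  have L2: "u \<in> L2" "w \<in> L2" "d \<in> L2" using u w d by (auto simp: harmonic_Bergman_def)
  have "L2_inner d d = L2_inner (\<lambda>z. f z - u z) d - L2_inner (\<lambda>z. f z - w z) d"
    unfolding L2_inner_def
    by (subst Bochner_Integration.integral_diff[symmetric])
      (auto intro!: L2_inner_integrable L2_diff f L2 Bochner_Integration.integral_cong simp: d_def algebra_simps)
  then have "L2_inner d d = 0" using orth[OF d] worth[OF d] by simp
  then have "d z = 0" using harmonic_Bergman_eq_zero[OF d _ z] by simp
  then show ?thesis by (simp add: d_def w_def)
qed

text \<open>The defining predicate of \<open>Q\<close> sees its argument only through integrals over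
  the disk, so both choices are made from the same predicate. This matters because Toeplitz images
  are known only on the disk.\<close>

lemma Q_cong:
  assumes "\<And>z. z \<in> disk \<Longrightarrow> f z = g z" shows "Q f = Q g"
proof -
  have "L2_inner (\<lambda>z. f z - u z) v = L2_inner (\<lambda>z. g z - u z) v" for u v
    unfolding L2_inner_def by (intro Bochner_Integration.integral_cong) (auto simp: assms)
  then show ?thesis by (simp add: Q_def)
qed

section \<open>Orthogonality of functions of fixed angular degree to harmonic functions\<close>

text \<open>The symbols \<open>e\<^bsup>in\<theta>\<^esup>\<phi>(r)\<close>, described without polar coordinates.\<close>

definition angular_degree :: "int \<Rightarrow> (complex \<Rightarrow> complex) \<Rightarrow> bool" where
  "angular_degree n F \<longleftrightarrow>
     (\<forall>\<omega> z. cmod \<omega> = 1 \<longrightarrow> z \<in> disk \<longrightarrow> z \<noteq> 0 \<longrightarrow> F (\<omega> * z) = \<omega> powi n * F z)"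

text \<open>A rotation by \<open>\<omega>\<close> with \<open>\<omega> powi n = -1\<close> preserves
  the integral and also changes its sign.\<close>

lemma integral_homogeneous_eq_zero:
  assumes F: "F \<in> borel_measurable dA"
    and hom: "angular_degree n F"
    and n: "n \<noteq> 0"
  shows "(LINT z|dA. F z) = 0"
proof -
  define \<omega> where "\<omega> = cis (pi / of_int n)"
  have \<omega>: "cmod \<omega> = 1" "\<omega> powi n = -1"
    using n by (simp_all add: \<omega>_def cis_power_int)
  have "(LINT z|dA. F z) = (LINT z|dA. F (\<omega> * z))"
    using dA_integral_rotation(1)[OF \<omega>(1) F] by simp
  also have "\<dots> = (LINT z|dA. - F z)"
  proof (intro integral_cong_AE dA_integral_rotation(2) \<omega> F)
    show "(\<lambda>z. - F z) \<in> borel_measurable dA" using F by simp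
    have "AE z in dA. z \<in> disk" using AE_space[of dA] by simp
    with AE_dA_nonzero show "AE z in dA. F (\<omega> * z) = - F z"
      by eventually_elim (use hom \<omega> in \<open>simp add: angular_degree_def\<close>)
  qed
  finally show ?thesis by simp
qed

lemma angular_degree_indicator_power:
  assumes "angular_degree n F"
  shows "angular_degree (n + int k) (\<lambda>z. indicator (ball 0 r) z * F z * (a * z ^ k))"
  unfolding angular_degree_def
proof (intro allI impI)
  fix \<omega> z :: complex assume *: "cmod \<omega> = 1" "z \<in> disk" "z \<noteq> 0"
  have "\<omega> \<noteq> 0" using *(1) by auto
  moreover have "indicator (ball 0 r) (\<omega> * z) = (indicator (ball 0 r) z :: complex)"
    using * by (simp add: indicator_def norm_mult)
  moreover have "F (\<omega> * z) = \<omega> powi n * F z"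
    using assms * by (simp add: angular_degree_def)
  ultimately show "indicator (ball 0 r) (\<omega> * z) * F (\<omega> * z) * (a * (\<omega> * z) ^ k)
      = \<omega> powi (n + int k) * (indicator (ball 0 r) z * F z * (a * z ^ k))"
    by (simp add: power_int_add power_mult_distrib)
qed

lemma angular_degree_cnj:
  assumes "angular_degree n F" shows "angular_degree (- n) (\<lambda>z. cnj (F z))"
  using assms by (auto simp: angular_degree_def cnj_unit power_int_minus power_int_inverse)

lemma borel_measurable_cnj:
  assumes "F \<in> borel_measurable M" shows "(\<lambda>z. cnj (F z)) \<in> borel_measurable M"
  using assms by (rule borel_measurable_continuous_on[OF continuous_on_cnj[OF continuous_on_id]])

lemma indicator_ball_measurable: "(indicator (ball 0 r) :: complex \<Rightarrow> complex) \<in> borel_measurable dA"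
  by (rule borel_measurable_dA_borel) (rule borel_measurable_indicator, simp)

text \<open>The Taylor series of \<open>f\<close> is integrated term by term, and the k-th term has
  angular degree \<open>n + int k\<close>, so only k = -n can survive. The cutoff to a smaller disk
  is there because \<open>f\<close> may be unbounded near the unit circle.\<close>

lemma integral_homogeneous_holomorphic:
  assumes f: "f holomorphic_on disk" and r: "0 < r" "r < 1"
    and F: "F \<in> borel_measurable dA" and B: "\<And>z. z \<in> disk \<Longrightarrow> cmod (F z) \<le> B"
    and hom: "angular_degree n F"
  shows "integrable dA (\<lambda>z. indicator (ball 0 r) z * F z * f z)"
    and "(LINT z|dA. indicator (ball 0 r) z * F z * f z) =
      (if n \<le> 0 then (deriv ^^ nat (- n)) f 0 / fact (nat (- n))
         * (LINT z|dA. indicator (ball 0 r) z * F z * z ^ nat (- n)) else 0)"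
proof -
  define a where "a k = (deriv ^^ k) f 0 / fact k" for k
  define T where "T k z = indicator (ball 0 r) z * F z * (a k * z ^ k)" for k z
  have B0: "0 \<le> B" using order_trans[OF norm_ge_zero B[of 0]] by simp
  have series: "(\<lambda>k. a k * z ^ k) sums f z" if "z \<in> disk" for z
    using holomorphic_power_series[OF f that] by (simp add: a_def)
  \<comment> \<open>A radius strictly between \<open>r\<close> and 1: convergence of the power
    series there gives absolute convergence at radius \<open>r\<close>.\<close>
  define \<rho> where "\<rho> = (1 + r) / 2"
  have \<rho>: "r < \<rho>" "0 < \<rho>" "\<rho> < 1" using r by (auto simp: \<rho>_def)
  have "summable (\<lambda>k. a k * of_real \<rho> ^ k)"
    by (rule sums_summable, rule series) (use \<rho> in simp)
  then have sm: "summable (\<lambda>k. cmod (a k * of_real r ^ k))"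
    by (rule powser_insidea) (use r \<rho> in simp)
  have Tb: "cmod (T k z) \<le> B * cmod (a k * of_real r ^ k)" if "z \<in> disk" for k z
  proof (cases "z \<in> ball 0 r")
    case True
    then have "cmod z ^ k \<le> r ^ k" by (intro power_mono) auto
    then have "cmod (a k) * cmod z ^ k \<le> cmod (a k) * r ^ k" by (rule mult_left_mono) simp
    from mult_mono[OF B[OF that] this B0]
    have "cmod (F z) * (cmod (a k) * cmod z ^ k) \<le> B * (cmod (a k) * r ^ k)" by simp
    then show ?thesis using True r by (simp add: T_def norm_mult norm_power)
  next
    case False
    then show ?thesis using B0 by (simp add: T_def)
  qed
  have Tm: "T k \<in> borel_measurable dA" for k
    unfolding T_def
    by (intro borel_measurable_times indicator_ball_measurable F borel_measurable_dA_continuous continuous_intros)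
  have Ti: "integrable dA (T k)" for k
    using Tm Tb by (rule integrable_dA_bounded)
  have sums1: "AE z in dA. summable (\<lambda>k. norm (T k z))"
  proof (rule AE_I2)
    fix z assume "z \<in> space dA"
    then show "summable (\<lambda>k. norm (T k z))"
      by (intro summable_comparison_test'[OF summable_mult[OF sm, of B], of 0]) (auto intro!: Tb)
  qed
  have sums2: "summable (\<lambda>k. LINT z|dA. norm (T k z))"
  proof (rule summable_comparison_test'[OF summable_mult[OF sm, of "B"], of 0])
    fix k
    have "(LINT z|dA. norm (T k z)) \<le> (LINT z|dA. B * cmod (a k * of_real r ^ k))"
      by (intro integral_mono integrable_norm Ti integrable_dA_bounded[where B = "\<bar>B * cmod (a k * of_real r ^ k)\<bar>"])
        (auto intro: Tb)
    also have "\<dots> = B * cmod (a k * of_real r ^ k)"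
      using emeasure_dA_ball[of 1] by (simp add: measure_def)
    finally show "norm (LINT z|dA. norm (T k z)) \<le> B * cmod (a k * of_real r ^ k)"
      by simp
  qed
  have Tsum: "(\<Sum>k. T k z) = indicator (ball 0 r) z * F z * f z" if "z \<in> disk" for z
    unfolding T_def using sums_mult[OF series[OF that]] by (metis sums_unique)
  have "integrable dA (\<lambda>z. \<Sum>k. T k z)"
    by (rule integrable_suminf[OF Ti sums1 sums2])
  then show "integrable dA (\<lambda>z. indicator (ball 0 r) z * F z * f z)"
    by (rule Bochner_Integration.integrable_cong[THEN iffD1, rotated -1]) (auto simp: Tsum)
  have *: "(\<lambda>k. LINT z|dA. T k z) sums (LINT z|dA. indicator (ball 0 r) z * F z * f z)"
  proof -
    have "(LINT z|dA. (\<Sum>k. T k z)) = (LINT z|dA. indicator (ball 0 r) z * F z * f z)"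
      by (intro Bochner_Integration.integral_cong) (auto simp: Tsum)
    then show ?thesis using sums_integral[OF Ti sums1 sums2] by simp
  qed
  have T0: "(LINT z|dA. T k z) = 0" if "n + int k \<noteq> 0" for k
  proof (rule integral_homogeneous_eq_zero[OF Tm _ that])
    show "angular_degree (n + int k) (T k)"
      unfolding T_def by (rule angular_degree_indicator_power[OF hom])
  qed
  show "(LINT z|dA. indicator (ball 0 r) z * F z * f z) =
      (if n \<le> 0 then (deriv ^^ nat (- n)) f 0 / fact (nat (- n))
         * (LINT z|dA. indicator (ball 0 r) z * F z * z ^ nat (- n)) else 0)"
  proof (cases "n \<le> 0")
    case True
    have "(\<lambda>k. LINT z|dA. T k z) sums (\<Sum>k\<in>{nat (- n)}. LINT z|dA. T k z)"
      by (rule sums_finite) (use T0 True in auto)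
    then have "(LINT z|dA. indicator (ball 0 r) z * F z * f z) = (LINT z|dA. T (nat (- n)) z)"
      using * sums_unique2 by fastforce
    also have "\<dots> = (LINT z|dA. a (nat (- n)) * (indicator (ball 0 r) z * F z * z ^ nat (- n)))"
      by (simp add: T_def algebra_simps)
    finally show ?thesis using True by (simp add: a_def)
  next
    case False
    then have "(LINT z|dA. T k z) = 0" for k by (intro T0) auto
    then have "(\<lambda>k. LINT z|dA. T k z) sums 0" by simp
    from sums_unique2[OF * this] show ?thesis using False by simp
  qed
qed

text \<open>Writing \<open>v\<close> as \<open>f + cnj g\<close>, each part contributes at most one
  Taylor coefficient; the part with \<open>f\<close> is reduced to the holomorphic case by
  conjugation. The point is that \<open>C\<close> does not depend on \<open>r\<close>.\<close>

lemma integral_homogeneous_harmonic: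
  assumes v: "harmonic_on v disk"
    and F: "F \<in> borel_measurable dA" and B: "\<And>z. z \<in> disk \<Longrightarrow> cmod (F z) \<le> B"
    and hom: "angular_degree n F"
  obtains C where "\<And>r. 0 < r \<Longrightarrow> r < 1 \<Longrightarrow>
    (LINT z|dA. indicator (ball 0 r) z * F z * cnj (v z)) =
      C * (LINT z|dA. indicator (ball 0 r) z * F z * cnj (harmonic_monomial n z))"
proof -
  obtain f g where fg: "f holomorphic_on disk" "g holomorphic_on disk"
    and v: "\<And>z. z \<in> disk \<Longrightarrow> v z = f z + cnj (g z)"
    using harmonic_on_decompose[OF v] by auto
  \<comment> \<open>A positive degree sees only \<open>f\<close>, a negative one only
    \<open>g\<close>. In degree 0 both constant terms contribute, hence the sum of the two
    constants.\<close>
  define Cf where "Cf = (if 0 \<le> n then cnj ((deriv ^^ nat n) f 0 / fact (nat n)) else 0)"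
  define Cg where "Cg = (if n \<le> 0 then (deriv ^^ nat (- n)) g 0 / fact (nat (- n)) else 0)"
  show thesis
  proof (rule that[of "Cf + Cg"])
    fix r :: real assume r: "0 < r" "r < 1"
    let ?I = "LINT z|dA. indicator (ball 0 r) z * F z * cnj (harmonic_monomial n z)"
    have G: "(LINT z|dA. indicator (ball 0 r) z * F z * g z) = Cg * ?I"
      using integral_homogeneous_holomorphic(2)[OF fg(2) r F B hom]
      by (cases "n = 0") (auto simp: harmonic_monomial_def Cg_def)
    have cB: "cmod (cnj (F z)) \<le> B" if "z \<in> disk" for z using B[OF that] by simp
    note cF = borel_measurable_cnj[OF F] cB angular_degree_cnj[OF hom]
    have cind: "cnj (indicator (ball 0 r) z) = indicator (ball 0 r) z" for z
      by (simp add: indicator_def)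
    have Fi: "integrable dA (\<lambda>z. indicator (ball 0 r) z * F z * cnj (f z))"
      using integrable_cnj[OF integral_homogeneous_holomorphic(1)[OF fg(1) r cF]]
      by (simp add: cind)
    have cnj_int: "(LINT z|dA. indicator (ball 0 r) z * F z * cnj (h z)) =
        cnj (LINT z|dA. indicator (ball 0 r) z * cnj (F z) * h z)" for h
    proof -
      have "(LINT z|dA. indicator (ball 0 r) z * F z * cnj (h z)) =
          (LINT z|dA. cnj (indicator (ball 0 r) z * cnj (F z) * h z))"
        by (simp only: cind complex_cnj_mult complex_cnj_cnj)
      then show ?thesis by (simp only: Bochner_Integration.integral_cnj)
    qed
    have "(LINT z|dA. indicator (ball 0 r) z * F z * cnj (f z)) =
        cnj (LINT z|dA. indicator (ball 0 r) z * cnj (F z) * f z)"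
      by (rule cnj_int)
    also have "\<dots> = Cf * ?I"
    proof (cases "0 \<le> n")
      case True
      then have "?I = cnj (LINT z|dA. indicator (ball 0 r) z * cnj (F z) * z ^ nat n)"
        using cnj_int[of "\<lambda>z. z ^ nat n"] by (cases "n = 0") (simp_all add: harmonic_monomial_def)
      then show ?thesis
        using True integral_homogeneous_holomorphic(2)[OF fg(1) r cF] by (simp add: Cf_def)
    qed (use integral_homogeneous_holomorphic(2)[OF fg(1) r cF] in \<open>simp add: Cf_def\<close>)
    finally have F_f: "(LINT z|dA. indicator (ball 0 r) z * F z * cnj (f z)) = Cf * ?I" .
    have "(LINT z|dA. indicator (ball 0 r) z * F z * cnj (v z)) =
      (LINT z|dA. indicator (ball 0 r) z * F z * cnj (f z) + indicator (ball 0 r) z * F z * g z)"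
      by (intro Bochner_Integration.integral_cong) (auto simp: v algebra_simps)
    also have "\<dots> = (Cf + Cg) * ?I"
      using Fi integral_homogeneous_holomorphic(1)[OF fg(2) r F B hom]
      by (simp only: Bochner_Integration.integral_add F_f G distrib_right)
    finally show "(LINT z|dA. indicator (ball 0 r) z * F z * cnj (v z)) = (Cf + Cg) * ?I" .
  qed
qed

text \<open>The offset 2 starts the radii at 1/2, so that all of them lie strictly between 0 and 1
  while they tend to 1.\<close>

lemma integral_indicator_ball_limit:
  fixes f :: "complex \<Rightarrow> complex"
  assumes "integrable dA f"
  shows "(\<lambda>m. LINT z|dA. indicator (ball 0 (1 - 1 / real (m + 2))) z * f z) \<longlonglongrightarrow> (LINT z|dA. f z)"
proof (rule integral_dominated_convergence[where w = "\<lambda>z. norm (f z)"])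
  show "f \<in> borel_measurable dA" using assms by simp
  show "(\<lambda>z. indicator (ball 0 (1 - 1 / real (m + 2))) z * f z) \<in> borel_measurable dA" for m
    using assms by (intro borel_measurable_times indicator_ball_measurable) simp
  show "integrable dA (\<lambda>z. norm (f z))" using assms by simp
  show "AE z in dA. (\<lambda>m. indicator (ball 0 (1 - 1 / real (m + 2))) z * f z) \<longlonglongrightarrow> f z"
  proof (rule AE_I2)
    fix z assume "z \<in> space dA"
    then have z: "cmod z < 1" by simp
    have "(\<lambda>m. 1 - 1 / real (m + 2)) \<longlonglongrightarrow> 1 - 0"
      by (intro tendsto_diff tendsto_const LIMSEQ_ignore_initial_segment[OF lim_1_over_n])
    then have "eventually (\<lambda>m. cmod z < 1 - 1 / real (m + 2)) sequentially"
      using z by (intro order_tendstoD(1)) auto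
    then have "eventually (\<lambda>m. indicator (ball 0 (1 - 1 / real (m + 2))) z * f z = f z) sequentially"
      by eventually_elim (simp add: indicator_def)
    then show "(\<lambda>m. indicator (ball 0 (1 - 1 / real (m + 2))) z * f z) \<longlonglongrightarrow> f z"
      by (rule tendsto_eventually)
  qed
  show "AE z in dA. norm (indicator (ball 0 (1 - 1 / real (m + 2))) z * f z) \<le> norm (f z)" for m
    by (intro AE_I2) (auto simp: indicator_def)
qed

text \<open>Orthogonality to the whole space reduces to a single test function: on every smaller
  disk the pairing with \<open>v\<close> is the same multiple of the pairing with
  \<open>harmonic_monomial n\<close>, and the radius tends to 1.\<close>

lemma L2_inner_homogeneous_eq_zero:
  assumes F: "F \<in> borel_measurable dA" and B: "\<And>z. z \<in> disk \<Longrightarrow> cmod (F z) \<le> B"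
    and hom: "angular_degree n F" and 0: "L2_inner F (harmonic_monomial n) = 0"
    and v: "v \<in> harmonic_Bergman"
  shows "L2_inner F v = 0"
proof -
  have FL2: "F \<in> L2" using F B by (rule L2_bounded)
  have vL2: "v \<in> L2" "harmonic_monomial n \<in> L2" and vh: "harmonic_on v disk"
    using v harmonic_Bergman_harmonic_monomial[of 1 n] by (auto simp: harmonic_Bergman_def)
  obtain C where C: "\<And>r. 0 < r \<Longrightarrow> r < 1 \<Longrightarrow>
    (LINT z|dA. indicator (ball 0 r) z * F z * cnj (v z)) =
      C * (LINT z|dA. indicator (ball 0 r) z * F z * cnj (harmonic_monomial n z))"
    using integral_homogeneous_harmonic[OF vh F B hom] by blast
  have l1: "(\<lambda>m. LINT z|dA. indicator (ball 0 (1 - 1 / real (m + 2))) z * F z * cnj (v z)) \<longlonglongrightarrow> L2_inner F v"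
    using integral_indicator_ball_limit[OF L2_inner_integrable[OF FL2 vL2(1)]]
    by (simp add: L2_inner_def mult.assoc)
  have l2: "(\<lambda>m. C * (LINT z|dA. indicator (ball 0 (1 - 1 / real (m + 2))) z * F z * cnj (harmonic_monomial n z)))
      \<longlonglongrightarrow> C * L2_inner F (harmonic_monomial n)"
    using integral_indicator_ball_limit[OF L2_inner_integrable[OF FL2 vL2(2)]]
    by (intro tendsto_mult tendsto_const) (simp add: L2_inner_def mult.assoc)
  have "L2_inner F v = C * L2_inner F (harmonic_monomial n)"
    by (rule LIMSEQ_unique[OF l1]) (use l2 C in simp)
  then show ?thesis using 0 by simp
qed

section \<open>Toeplitz operators on monomials\<close>

text \<open>Trades \<open>Arg\<close>, with its branch cut, for \<open>sgn z\<close>, which is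
  multiplicative and Borel measurable.\<close>

lemma twist_polar:
  assumes "z \<noteq> 0" shows "twist s \<phi> z = sgn z ^ s * \<phi> z"
proof -
  have "cis (real s * Arg z) = sgn z ^ s"
    using Complex.DeMoivre[of "Arg z" s] cis_Arg[OF assms] by simp
  then show ?thesis by (simp only: twist_def)
qed

lemma twist_measurable:
  assumes "\<phi> \<in> borel_measurable dA" shows "twist s \<phi> \<in> borel_measurable dA"
proof (rule measurable_discrete_difference[where X = "{0}"])
  have "(\<lambda>z::complex. sgn z ^ s) \<in> borel_measurable borel"
    unfolding sgn_div_norm by measurable
  then show "(\<lambda>z. sgn z ^ s * \<phi> z) \<in> borel_measurable dA"
    by (intro borel_measurable_times borel_measurable_dA_borel assms)
qed (auto simp: twist_polar sets_dA sets_restrict_space_iff)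

lemma cmod_twist: "cmod (twist s \<phi> z) = cmod (\<phi> z)"
  by (simp add: twist_def norm_mult)

lemma angular_degree_twist:
  assumes "radial \<phi>" shows "angular_degree (int s) (twist s \<phi>)"
  unfolding angular_degree_def
proof (intro allI impI)
  fix \<omega> z :: complex assume *: "cmod \<omega> = 1" "z \<in> disk" "z \<noteq> 0"
  then have "\<phi> (\<omega> * z) = \<phi> z"
    by (intro assms[unfolded radial_def, rule_format]) (simp_all add: norm_mult)
  moreover have "\<omega> * z \<noteq> 0" "sgn \<omega> = \<omega>" using * by (auto simp: sgn_eq)
  ultimately show "twist s \<phi> (\<omega> * z) = \<omega> powi int s * twist s \<phi> z"
    using * by (simp add: twist_polar sgn_mult power_mult_distrib)
qed

lemma angular_degree_harmonic_monomial: "angular_degree n (harmonic_monomial n)"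
  by (simp add: angular_degree_def harmonic_monomial_rotate)

lemma angular_degree_mult:
  assumes "angular_degree m F" "angular_degree n G"
  shows "angular_degree (m + n) (\<lambda>z. F z * G z)"
  unfolding angular_degree_def
proof (intro allI impI)
  fix \<omega> z :: complex assume *: "cmod \<omega> = 1" "z \<in> disk" "z \<noteq> 0"
  then have "\<omega> \<noteq> 0" by auto
  then show "F (\<omega> * z) * G (\<omega> * z) = \<omega> powi (m + n) * (F z * G z)"
    using assms * by (simp add: angular_degree_def power_int_add)
qed

lemma angular_degree_diff:
  assumes "angular_degree n F" "angular_degree n G"
  shows "angular_degree n (\<lambda>z. F z - G z)"
  using assms by (simp add: angular_degree_def algebra_simps)

lemma angular_degree_cmult:
  assumes "angular_degree n F" shows "angular_degree n (\<lambda>z. c * F z)"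
  using assms by (simp add: angular_degree_def algebra_simps)

text \<open>The Mellin transform of the paper, \<open>\<integral>\<^sub>0\<^sup>1 \<phi>(r) r\<^bsup>n+1\<^esup> dr\<close>, up to a factor \<open>2\<close>.\<close>

definition radial_moment :: "(complex \<Rightarrow> complex) \<Rightarrow> nat \<Rightarrow> complex" where
  "radial_moment \<phi> n = (LINT z|dA. \<phi> z * of_real (cmod z ^ n))"

text \<open>The first factor is the reciprocal of the squared norm of
  \<open>harmonic_monomial (k + int s)\<close>; the moment is the inner product of the twisted
  symbol times \<open>harmonic_monomial k\<close> with that monomial.\<close>

definition Toeplitz_coeff :: "nat \<Rightarrow> (complex \<Rightarrow> complex) \<Rightarrow> int \<Rightarrow> complex" where
  "Toeplitz_coeff s \<phi> k =
     of_int (\<bar>k + int s\<bar> + 1) * radial_moment \<phi> (nat \<bar>k\<bar> + nat \<bar>k + int s\<bar>)"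

text \<open>The angular exponents s, k and -(k+s) cancel, which leaves the integrand of a radial
  moment.\<close>

lemma twist_harmonic_monomial_cnj_harmonic_monomial:
  assumes "z \<noteq> 0"
  shows "twist s \<phi> z * harmonic_monomial k z * cnj (harmonic_monomial (k + int s) z)
    = \<phi> z * of_real (cmod z ^ (nat \<bar>k\<bar> + nat \<bar>k + int s\<bar>))"
proof -
  have u: "cmod (sgn z) = 1" "sgn z \<noteq> 0" using assms by (auto simp: norm_sgn sgn_zero_iff)
  have "sgn z ^ s * sgn z powi k * cnj (sgn z powi (k + int s)) = 1"
    using u by (simp add: cnj_unit power_int_inverse power_int_add field_simps)
  then have "sgn z ^ s * \<phi> z * (sgn z powi k * a) * (cnj (sgn z powi (k + int s)) * b) = \<phi> z * (a * b)" for a b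
    by (metis (no_types, opaque_lifting) mult.assoc mult.commute mult.right_neutral)
  then show ?thesis
    unfolding twist_polar[OF assms] harmonic_monomial_polar[OF assms] complex_cnj_mult complex_cnj_complex_of_real
      power_add of_real_mult .
qed

text \<open>The product of symbol and monomial has angular degree \<open>k + int s\<close>, so its
  projection is found by matching one inner product. The hypothesis on \<open>u\<close> concerns the
  disk only, so that the lemma also applies to the output of another Toeplitz operator.\<close>

lemma Toeplitz_twist_harmonic_monomial:
  assumes \<phi>: "\<phi> \<in> borel_measurable dA" "bounded (\<phi> ` disk)" "radial \<phi>"
    and u: "\<And>z. z \<in> disk \<Longrightarrow> u z = c * harmonic_monomial k z" and z: "z \<in> disk"
  shows "Toeplitz (twist s \<phi>) u z = c * Toeplitz_coeff s \<phi> k * harmonic_monomial (k + int s) z"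
proof -
  define n where "n = k + int s"
  define \<mu> where "\<mu> = c * Toeplitz_coeff s \<phi> k"
  obtain B where B: "\<And>z. z \<in> disk \<Longrightarrow> cmod (\<phi> z) \<le> B"
    using \<phi>(2) unfolding bounded_iff by (metis imageI)
  have B0: "0 \<le> B" using order_trans[OF norm_ge_zero B[of 0]] by simp
  define f where "f z = twist s \<phi> z * (c * harmonic_monomial k z)" for z
  have fm: "f \<in> borel_measurable dA"
    unfolding f_def
    by (intro borel_measurable_times twist_measurable \<phi> harmonic_monomial_measurable borel_measurable_const)
  have fB: "cmod (f z) \<le> B * cmod c" if "z \<in> disk" for z
    using mult_mono[OF B[OF that] mult_left_le[OF cmod_harmonic_monomial_le[OF that, of k] norm_ge_zero[of c]] B0]
    by (simp add: f_def norm_mult cmod_twist)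
  have fL2: "f \<in> L2" using fm fB by (rule L2_bounded)
  have fdeg: "angular_degree n f"
    using angular_degree_mult[OF angular_degree_twist[OF \<phi>(3), of s] angular_degree_cmult[OF angular_degree_harmonic_monomial[of k], of c]]
    unfolding f_def n_def by (simp add: add.commute)
  have hL2: "harmonic_monomial n \<in> L2" "(\<lambda>z. \<mu> * harmonic_monomial n z) \<in> L2"
    using harmonic_Bergman_harmonic_monomial[of 1 n] harmonic_Bergman_harmonic_monomial[of \<mu> n] by (simp_all add: harmonic_Bergman_def)
  let ?m = "nat \<bar>k\<bar> + nat \<bar>n\<bar>"
  have 1: "L2_inner f (harmonic_monomial n) = c * radial_moment \<phi> ?m"
  proof -
    have "L2_inner f (harmonic_monomial n) = (LINT z|dA. c * (\<phi> z * of_real (cmod z ^ ?m)))"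
      unfolding L2_inner_def
    proof (rule integral_cong_AE)
      show "(\<lambda>z. f z * cnj (harmonic_monomial n z)) \<in> borel_measurable dA"
        by (intro borel_measurable_times fm borel_measurable_cnj harmonic_monomial_measurable)
      show "(\<lambda>z. c * (\<phi> z * of_real (cmod z ^ ?m))) \<in> borel_measurable dA"
        by (intro borel_measurable_times \<phi> borel_measurable_const borel_measurable_dA_continuous continuous_intros)
      show "AE z in dA. f z * cnj (harmonic_monomial n z) = c * (\<phi> z * of_real (cmod z ^ ?m))"
        using AE_dA_nonzero
      proof eventually_elim
        case (elim z)
        have "f z * cnj (harmonic_monomial n z) = c * (twist s \<phi> z * harmonic_monomial k z * cnj (harmonic_monomial n z))"
          by (simp add: f_def)
        then show ?case using twist_harmonic_monomial_cnj_harmonic_monomial[OF elim, of s \<phi> k] by (simp only: n_def)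
      qed
    qed
    then show ?thesis by (simp add: radial_moment_def)
  qed
  have 2: "L2_inner (\<lambda>z. \<mu> * harmonic_monomial n z) (harmonic_monomial n) = \<mu> / of_int (\<bar>n\<bar> + 1)"
  proof -
    have "L2_inner (\<lambda>z. \<mu> * harmonic_monomial n z) (harmonic_monomial n) = (LINT z|dA. \<mu> * of_real (cmod z ^ (2 * nat \<bar>n\<bar>)))"
      unfolding L2_inner_def by (simp only: mult.assoc harmonic_monomial_mult_cnj_self)
    also have "\<dots> = \<mu> * of_real (2 / (real (2 * nat \<bar>n\<bar>) + 2))"
      by (simp only: integral_mult_right_zero integral_complex_of_real integral_dA_cmod_power)
    also have "2 / (real (2 * nat \<bar>n\<bar>) + 2) = 1 / of_int (\<bar>n\<bar> + 1)"
    proof -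
      have "2 / (2 * x + 2) = 1 / (x + 1)" if "x \<ge> 0" for x :: real
        using that by (simp add: field_simps)
      from this[of "of_int \<bar>n\<bar>"] show ?thesis by simp
    qed
    also have "complex_of_real (1 / of_int (\<bar>n\<bar> + 1)) = 1 / of_int (\<bar>n\<bar> + 1)"
      by (simp only: of_real_divide of_real_1 of_real_of_int_eq)
    finally show ?thesis by (simp only: times_divide_eq_right mult_1_right)
  qed
  have "of_int (\<bar>n\<bar> + 1) \<noteq> (0 :: complex)"
    by (metis abs_ge_zero add.commute of_int_eq_0_iff zle_add1_eq_le less_irrefl)
  then have 3: "L2_inner (\<lambda>z. f z - \<mu> * harmonic_monomial n z) (harmonic_monomial n) = 0"
    using 1 2 unfolding L2_inner_def
    by (simp add: left_diff_distrib Bochner_Integration.integral_diff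
        L2_inner_integrable[OF fL2 hL2(1)] L2_inner_integrable[OF hL2(2,1)])
      (simp add: \<mu>_def Toeplitz_coeff_def n_def)
  have "Q f z = \<mu> * harmonic_monomial n z"
  proof (rule Q_eqI[OF fL2 harmonic_Bergman_harmonic_monomial _ z])
    fix v assume v: "v \<in> harmonic_Bergman"
    show "L2_inner (\<lambda>z. f z - \<mu> * harmonic_monomial n z) v = 0"
    proof (rule L2_inner_homogeneous_eq_zero[OF _ _ _ 3 v])
      show "(\<lambda>z. f z - \<mu> * harmonic_monomial n z) \<in> borel_measurable dA"
        by (intro borel_measurable_diff borel_measurable_times fm harmonic_monomial_measurable borel_measurable_const)
      show "cmod (f z - \<mu> * harmonic_monomial n z) \<le> B * cmod c + cmod \<mu>" if "z \<in> disk" for z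
        using norm_triangle_ineq4[of "f z" "\<mu> * harmonic_monomial n z"] fB[OF that]
          mult_left_le[OF cmod_harmonic_monomial_le[OF that, of n] norm_ge_zero[of \<mu>]]
        by (simp only: norm_mult)
      show "angular_degree n (\<lambda>z. f z - \<mu> * harmonic_monomial n z)"
        by (intro angular_degree_diff angular_degree_cmult angular_degree_harmonic_monomial fdeg)
    qed
  qed
  moreover have "Toeplitz (twist s \<phi>) u = Q f"
    unfolding Toeplitz_def by (intro Q_cong) (simp add: f_def u)
  ultimately show ?thesis by (simp add: \<mu>_def n_def)
qed

lemma radial_power_symbol:
  assumes "0 \<le> \<alpha>"
  shows "radial_power \<alpha> \<in> borel_measurable dA" "bounded (radial_power \<alpha> ` disk)" "radial (radial_power \<alpha>)"
    and "radial_moment (radial_power \<alpha>) n = 2 / (of_nat n + of_real \<alpha> + 2)"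
proof -
  show "radial_power \<alpha> \<in> borel_measurable dA"
    unfolding radial_power_def[abs_def] by (rule borel_measurable_dA_borel) measurable
  have "cmod z powr \<alpha> \<le> 1" if "cmod z < 1" for z :: complex
    using that assms by (intro powr_le1) auto
  then show "bounded (radial_power \<alpha> ` disk)"
    by (auto simp: bounded_iff radial_power_def intro!: exI[of _ 1])
  show "radial (radial_power \<alpha>)" by (simp add: radial_def radial_power_def)
  have "radial_moment (radial_power \<alpha>) n = of_real (LINT z|dA. cmod z ^ n * cmod z powr \<alpha>)"
    unfolding radial_moment_def radial_power_def of_real_mult[symmetric] of_real_power[symmetric]
    by (simp only: mult.commute integral_complex_of_real)
  then show "radial_moment (radial_power \<alpha>) n = 2 / (of_nat n + of_real \<alpha> + 2)"
    using assms by (simp add: integral_dA_cmod_power_powr)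
qed

text \<open>Both compositions send \<open>harmonic_monomial k\<close> to a multiple of the monomial
  of index \<open>k + int p + int s\<close>.\<close>

lemma commute_coeff:
  assumes \<phi>: "\<phi> \<in> borel_measurable dA" "bounded (\<phi> ` disk)" "radial \<phi>"
    and \<eta>: "\<eta> \<in> borel_measurable dA" "bounded (\<eta> ` disk)" "radial \<eta>"
    and comm: "commute_on_Bergman (Toeplitz (twist s \<phi>)) (Toeplitz (twist p \<eta>))"
  shows "Toeplitz_coeff p \<eta> k * Toeplitz_coeff s \<phi> (k + int p)
    = Toeplitz_coeff s \<phi> k * Toeplitz_coeff p \<eta> (k + int s)"
proof -
  have h: "harmonic_monomial k \<in> harmonic_Bergman" using harmonic_Bergman_harmonic_monomial[of 1 k] by simp
  \<comment> \<open>A nonzero point of the disk, where no monomial vanishes, so that the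
    coefficients can be compared.\<close>
  let ?z = "1 / 2 :: complex"
  have z: "?z \<in> disk" by simp
  have a: "Toeplitz (twist p \<eta>) (harmonic_monomial k) w = Toeplitz_coeff p \<eta> k * harmonic_monomial (k + int p) w" if "w \<in> disk" for w
    using Toeplitz_twist_harmonic_monomial[OF \<eta>, of "harmonic_monomial k" 1 k w p] that by simp
  have b: "Toeplitz (twist s \<phi>) (harmonic_monomial k) w = Toeplitz_coeff s \<phi> k * harmonic_monomial (k + int s) w" if "w \<in> disk" for w
    using Toeplitz_twist_harmonic_monomial[OF \<phi>, of "harmonic_monomial k" 1 k w s] that by simp
  have "Toeplitz (twist s \<phi>) (Toeplitz (twist p \<eta>) (harmonic_monomial k)) ?z
      = Toeplitz (twist p \<eta>) (Toeplitz (twist s \<phi>) (harmonic_monomial k)) ?z"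
    using comm h z unfolding commute_on_Bergman_def by blast
  then have "Toeplitz_coeff p \<eta> k * Toeplitz_coeff s \<phi> (k + int p) * harmonic_monomial (k + int p + int s) ?z
      = Toeplitz_coeff s \<phi> k * Toeplitz_coeff p \<eta> (k + int s) * harmonic_monomial (k + int s + int p) ?z"
    using Toeplitz_twist_harmonic_monomial[OF \<phi> a z, of s] Toeplitz_twist_harmonic_monomial[OF \<eta> b z, of p] by simp
  moreover have "harmonic_monomial (k + int p + int s) ?z \<noteq> 0"
    by (simp add: harmonic_monomial_def)
  moreover have "k + int s + int p = k + int p + int s" by simp
  ultimately show ?thesis by (metis mult_right_cancel)
qed

section \<open>The recurrence for the moments\<close>

lemma moment_denominator_nonzero:
  assumes "0 \<le> \<alpha>" shows "of_nat n + of_real \<alpha> + 2 \<noteq> (0 :: complex)"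
proof -
  have "of_nat n + of_real \<alpha> + 2 = (of_real (real n + \<alpha> + 2) :: complex)" by simp
  then show ?thesis using assms by (simp only: of_real_eq_0_iff)
qed

lemma radial_moment_recurrence:
  assumes \<phi>: "\<phi> \<in> borel_measurable dA" "bounded (\<phi> ` disk)" "radial \<phi>" and \<alpha>: "0 \<le> \<alpha>"
    and comm: "commute_on_Bergman (Toeplitz (twist s \<phi>)) (Toeplitz (twist p (radial_power \<alpha>)))"
  shows "(of_nat (nat \<bar>k + int p\<bar>) + 1) * (of_nat (nat \<bar>k + int s\<bar> + nat \<bar>k + int s + int p\<bar>) + of_real \<alpha> + 2)
      * radial_moment \<phi> (nat \<bar>k + int p\<bar> + nat \<bar>k + int p + int s\<bar>)
    = (of_nat (nat \<bar>k + int s\<bar>) + 1) * (of_nat (nat \<bar>k\<bar> + nat \<bar>k + int p\<bar>) + of_real \<alpha> + 2)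
      * radial_moment \<phi> (nat \<bar>k\<bar> + nat \<bar>k + int s\<bar>)"
proof -
  note D = moment_denominator_nonzero[OF \<alpha>]
  have I: "of_int (\<bar>n\<bar> + 1) = (of_nat (nat \<bar>n\<bar>) + 1 :: complex)" for n :: int by simp
  have Y: "of_nat n + 1 \<noteq> (0 :: complex)" for n
    by (metis of_nat_Suc of_nat_neq_0 add.commute)
  \<comment> \<open>Here \<open>y\<close> is the factor
    \<open>\<bar>k + int p + int s\<bar> + 1\<close> common to both compositions, while
    \<open>d\<close> and \<open>e\<close> are the denominators of the two moments of the radial
    power.\<close>
  have alg: "x * e * m = z * d * m'"
    if "x * (2 / d) * (y * m) = z * m' * (y * (2 / e))" "y \<noteq> 0" "d \<noteq> 0" "e \<noteq> 0" for x y z d e m m' :: complex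
    using that by (simp add: field_simps)
  have eq: "k + int s + int p = k + int p + int s" by simp
  note C = commute_coeff[OF \<phi> radial_power_symbol(1-3)[OF \<alpha>] comm, of k,
      unfolded Toeplitz_coeff_def radial_power_symbol(4)[OF \<alpha>] I eq]
  show ?thesis
    unfolding eq by (rule alg[OF C Y D D])
qed

text \<open>The sequence \<open>2 / (n + \<alpha> + 2)\<close> is the moment sequence of the radial
  power itself; \<open>c\<close> is the ratio of \<open>m\<close> to it.\<close>

lemma moments_from_recurrence:
  fixes m :: "nat \<Rightarrow> complex"
  assumes "0 < p" "p \<le> s" "0 < \<alpha>"
    and rec: "\<And>k. (of_nat (nat \<bar>k + int p\<bar>) + 1)
      * (of_nat (nat \<bar>k + int s\<bar> + nat \<bar>k + int s + int p\<bar>) + of_real \<alpha> + 2)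
      * m (nat \<bar>k + int p\<bar> + nat \<bar>k + int p + int s\<bar>)
    = (of_nat (nat \<bar>k + int s\<bar>) + 1) * (of_nat (nat \<bar>k\<bar> + nat \<bar>k + int p\<bar>) + of_real \<alpha> + 2)
      * m (nat \<bar>k\<bar> + nat \<bar>k + int s\<bar>)"
  obtains c where "c = 0 \<or> s = p" "\<And>j. m (s + 2 * j) = c * (2 / (of_nat (s + 2 * j) + of_real \<alpha> + 2))"
proof -
  have D: "of_nat n + of_real \<alpha> + 2 \<noteq> (0 :: complex)" for n
    using moment_denominator_nonzero[of \<alpha> n] \<open>0 < \<alpha>\<close> by simp
  have Y: "of_nat n + 1 \<noteq> (0 :: complex)" for n
    by (metis of_nat_Suc of_nat_neq_0 add.commute)
  have up: "(of_nat (j + p) + 1) * (of_nat (j + s + (j + s + p)) + of_real \<alpha> + 2) * m (s + 2 * (j + p))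
      = (of_nat (j + s) + 1) * (of_nat (j + (j + p)) + of_real \<alpha> + 2) * m (s + 2 * j)" for j
  proof -
    have "nat \<bar>int j + int p\<bar> = j + p" "nat \<bar>int j + int s\<bar> = j + s" "nat \<bar>int j\<bar> = j"
      "nat \<bar>int j + int s + int p\<bar> = j + s + p" "nat \<bar>int j + int p + int s\<bar> = j + p + s" by auto
    moreover have "j + p + (j + p + s) = s + 2 * (j + p)" "j + (j + s) = s + 2 * j" by auto
    ultimately show ?thesis using rec[of "int j"] by metis
  qed
  \<comment> \<open>For k = j - p between -p and 0, the absolute values satisfy
    \<open>\<bar>k\<bar> + \<bar>k + s\<bar> = s\<close>, so the right-hand side always involves
    \<open>m s\<close>. The case \<open>j = 0\<close> compares \<open>m s\<close> with
    itself.\<close>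
  have mid: "(of_nat j + 1) * (of_nat (s - p + j + (s + j)) + of_real \<alpha> + 2) * m (s + 2 * j)
      = (of_nat (s - p + j) + 1) * (of_nat p + of_real \<alpha> + 2) * m s" if "j \<le> p" for j
  proof -
    define k where "k = int j - int p"
    have "nat \<bar>k + int p\<bar> = j" "nat \<bar>k + int s\<bar> = s - p + j" "nat \<bar>k\<bar> = p - j"
      "nat \<bar>k + int s + int p\<bar> = s + j" "nat \<bar>k + int p + int s\<bar> = j + s"
      using that \<open>p \<le> s\<close> by (auto simp: k_def)
    moreover have "p - j + j = p" "p - j + (s - p + j) = s" "j + (j + s) = s + 2 * j"
      using that \<open>p \<le> s\<close> by auto
    ultimately show ?thesis using rec[of k] by metis
  qed
  show thesis
  proof (cases "s = p")
    case True
    \<comment> \<open>Read off from the desired formula at \<open>j = 0\<close>, where the index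
      \<open>s\<close> equals \<open>p\<close>.\<close>
    define c where "c = m s * (of_nat p + of_real \<alpha> + 2) / 2"
    have c: "m s * (of_nat p + of_real \<alpha> + 2) = c * 2" by (simp add: c_def)
    \<comment> \<open>For \<open>s = p\<close> the leading factors on both sides of
      \<open>mid\<close> and \<open>up\<close> agree, and the rest says that this product is
      constant. Indices up to \<open>p\<close> come from \<open>mid\<close>; larger ones go back by
      \<open>p\<close> through \<open>up\<close>, hence the strong induction.\<close>
    have mc: "m (s + 2 * j) * (of_nat (s + 2 * j) + of_real \<alpha> + 2) = c * 2" for j
    proof (induction j rule: less_induct)
      case (less j)
      show ?case
      proof (cases "j \<le> p")
        case j: True
        have e: "j + (s + j) = s + 2 * j" "s - p + j = j" using True by auto
        have "(of_nat j + 1) * (m (s + 2 * j) * (of_nat (s + 2 * j) + of_real \<alpha> + 2)) = (of_nat j + 1) * (c * 2)"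
          using mid[OF j] unfolding e c[symmetric] by (simp only: mult.assoc mult.commute mult.left_commute)
        then show ?thesis using Y[of j] by simp
      next
        case False
        define i where "i = j - p"
        have i: "i < j" "j = i + p" using False \<open>0 < p\<close> by (auto simp: i_def)
        have e: "i + p + (i + p + p) = s + 2 * (i + p)" "i + s = i + p" "i + (i + p) = s + 2 * i"
          using True by auto
        have "(of_nat (i + p) + 1) * (m (s + 2 * (i + p)) * (of_nat (s + 2 * (i + p)) + of_real \<alpha> + 2))
            = (of_nat (i + p) + 1) * (m (s + 2 * i) * (of_nat (s + 2 * i) + of_real \<alpha> + 2))"
          using up[of i] unfolding e by (simp only: mult.assoc mult.commute mult.left_commute)
        then show ?thesis using Y[of "i + p"] less[OF i(1)] unfolding i(2)[symmetric] by simp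
      qed
    qed
    show thesis
    proof (rule that[of c])
      show "c = 0 \<or> s = p" using True ..
      show "m (s + 2 * j) = c * (2 / (of_nat (s + 2 * j) + of_real \<alpha> + 2))" for j
        unfolding times_divide_eq_right nonzero_eq_divide_eq[OF D] by (rule mc)
    qed
  next
    case False
    define d where "d = s - p"
    have d: "s = p + d" "d > 0" using False \<open>p \<le> s\<close> by (auto simp: d_def)
    have "m s = 0"
    proof (rule ccontr)
      assume "m s \<noteq> 0"
      then have "of_nat (s - p + s) + of_real \<alpha> + 2 = (of_nat (s - p) + 1) * (of_nat p + of_real \<alpha> + 2 :: complex)"
        using mid[of 0] by simp
      then have "of_real (real (d + s) + \<alpha> + 2) = (of_real ((real d + 1) * (real p + \<alpha> + 2)) :: complex)"
        by (simp add: d_def)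
      then have "real (d + s) + \<alpha> + 2 = (real d + 1) * (real p + \<alpha> + 2)"
        by (simp only: of_real_eq_iff)
      \<comment> \<open>With \<open>s = p + d\<close> the two sides of the previous equation differ
        by exactly this product, which is positive.\<close>
      then have "real d * (real p + \<alpha>) = 0" by (simp add: d(1) algebra_simps)
      then show False using d(2) \<open>0 < \<alpha>\<close> by simp
    qed
    have "m (s + 2 * j) = 0" for j
    proof (induction j rule: less_induct)
      case (less j)
      show ?case
      proof (cases "j \<le> p")
        case True
        then show ?thesis using mid[OF True] Y[of j] D \<open>m s = 0\<close> by (simp del: of_nat_add)
      next
        case False
        define i where "i = j - p"
        have i: "i < j" "j = i + p" using False \<open>0 < p\<close> by (auto simp: i_def)
        then show ?thesis using up[of i] less[OF i(1)] Y[of "i + p"] D by (simp del: of_nat_add)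
      qed
    qed
    then show thesis by (intro that[of 0]) auto
  qed
qed

section \<open>From the moments back to the symbol\<close>

theorem theorem6:
  fixes p s :: nat and \<alpha> :: real and \<psi> :: "complex \<Rightarrow> complex"
  assumes "0 < p" and "0 < s" and "p \<le> s" and "0 < \<alpha>"
    and "\<psi> \<in> borel_measurable dA" and "bounded (\<psi> ` disk)" and "radial \<psi>"
    and "commute_on_Bergman (Toeplitz (twist s \<psi>)) (Toeplitz (twist p (radial_power \<alpha>)))"
  shows "(s = p \<and> (\<exists>c::complex. AE z in dA. \<psi> z = c * radial_power \<alpha> z))
         \<or> (AE z in dA. \<psi> z = 0)"
proof -
  have \<alpha>: "0 \<le> \<alpha>" using assms(4) by simp
  obtain c where c: "c = 0 \<or> s = p"
    and mom: "\<And>j. radial_moment \<psi> (s + 2 * j) = c * (2 / (of_nat (s + 2 * j) + of_real \<alpha> + 2))"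
    using moments_from_recurrence[OF assms(1,3,4) radial_moment_recurrence[OF assms(5-7) \<alpha> assms(8)]]
    by blast
  note rp = radial_power_symbol[OF \<alpha>]
  \<comment> \<open>The moments are known only at the exponents \<open>s + 2 * j\<close>. Absorbing
    \<open>cmod z ^ s\<close> into the function leaves the even powers that
    \<open>radial_moments_zero\<close> asks for; this weight is nonzero off the origin and is
    cancelled at the end.\<close>
  define h where "h z = (\<psi> z - c * radial_power \<alpha> z) * of_real (cmod z ^ s)" for z
  obtain B where B: "\<And>z. z \<in> disk \<Longrightarrow> cmod (\<psi> z) \<le> B"
    using assms(6) unfolding bounded_iff by (metis imageI)
  obtain B' where B': "\<And>z. z \<in> disk \<Longrightarrow> cmod (radial_power \<alpha> z) \<le> B'"
    using rp(2) unfolding bounded_iff by (metis imageI)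
  have pw: "(\<lambda>z. complex_of_real (cmod z ^ n)) \<in> borel_measurable dA" for n
    by (intro borel_measurable_dA_continuous continuous_intros)
  have int: "integrable dA (\<lambda>z. \<phi> z * of_real (cmod z ^ n))"
    if \<phi>: "\<phi> \<in> borel_measurable dA" "\<And>z. z \<in> disk \<Longrightarrow> cmod (\<phi> z) \<le> K" for \<phi> K n
  proof (rule integrable_dA_bounded[where B = K])
    show "(\<lambda>z. \<phi> z * of_real (cmod z ^ n)) \<in> borel_measurable dA"
      by (intro borel_measurable_times \<phi>(1) pw)
    show "norm (\<phi> z * complex_of_real (cmod z ^ n)) \<le> K" if z: "z \<in> disk" for z
    proof -
      have "cmod z ^ n \<le> 1" using z by (simp add: power_le_one)
      then have "cmod (\<phi> z) * cmod z ^ n \<le> cmod (\<phi> z)" by (rule mult_left_le) simp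
      also have "\<dots> \<le> K" by (rule \<phi>(2)[OF z])
      finally show ?thesis by (simp add: norm_mult norm_power)
    qed
  qed
  have "AE z in dA. h z = 0"
  proof (rule radial_moments_zero)
    show "h \<in> borel_measurable dA"
      unfolding h_def
      by (intro borel_measurable_times borel_measurable_diff pw assms(5) rp(1) borel_measurable_const)
    show "bounded (h ` disk)"
      unfolding bounded_iff
    proof (intro exI ballI)
      fix w assume "w \<in> h ` disk"
      then obtain z where z: "z \<in> disk" "w = h z" by blast
      have "cmod z ^ s \<le> 1" using z by (simp add: power_le_one)
      then have "cmod w \<le> cmod (\<psi> z - c * radial_power \<alpha> z)"
        unfolding z(2) h_def norm_mult by (intro mult_left_le) (simp_all add: norm_power)
      also have "\<dots> \<le> cmod (\<psi> z) + cmod c * cmod (radial_power \<alpha> z)"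
        unfolding norm_mult[symmetric] by (rule norm_triangle_ineq4)
      also have "\<dots> \<le> B + cmod c * B'"
        by (intro add_mono mult_left_mono B B' z) simp
      finally show "cmod w \<le> B + cmod c * B'" .
    qed
    show "radial h"
      unfolding radial_def
    proof (intro ballI impI)
      fix z w assume *: "z \<in> disk" "w \<in> disk" "cmod z = cmod w"
      have "\<psi> z = \<psi> w" "radial_power \<alpha> z = radial_power \<alpha> w"
        using * assms(7) rp(3) unfolding radial_def by blast+
      then show "h z = h w" using * by (simp add: h_def)
    qed
    show "(LINT z|dA. h z * of_real (((cmod z)\<^sup>2) ^ j)) = 0" for j
    proof -
      have "(LINT z|dA. h z * of_real (((cmod z)\<^sup>2) ^ j)) =
        (LINT z|dA. \<psi> z * of_real (cmod z ^ (s + 2 * j)) - c * (radial_power \<alpha> z * of_real (cmod z ^ (s + 2 * j))))"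
      proof (intro Bochner_Integration.integral_cong refl)
        fix z
        have "cmod z ^ s * ((cmod z)\<^sup>2) ^ j = cmod z ^ (s + 2 * j)"
          by (simp add: power_add power_mult)
        then show "h z * of_real (((cmod z)\<^sup>2) ^ j) = \<psi> z * of_real (cmod z ^ (s + 2 * j))
            - c * (radial_power \<alpha> z * of_real (cmod z ^ (s + 2 * j)))"
          by (simp only: h_def mult.assoc of_real_mult[symmetric] left_diff_distrib)
      qed
      also have "\<dots> = radial_moment \<psi> (s + 2 * j) - c * radial_moment (radial_power \<alpha>) (s + 2 * j)"
        unfolding radial_moment_def
        by (subst Bochner_Integration.integral_diff)
          (intro integrable_mult_right int[OF assms(5) B] int[OF rp(1) B'] | simp)+
      finally show ?thesis by (simp only: mom rp(4) diff_self)
    qed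
  qed
  then have "AE z in dA. \<psi> z = c * radial_power \<alpha> z"
    using AE_dA_nonzero by eventually_elim (simp add: h_def)
  then show ?thesis using c by auto
qed

end
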